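(* Let $q=q_1/q_2\in\mathbb Q$ with $q_1,q_2\in\mathbb Z\setminus\{0\}$, $\gcd(q_1,q_2)=1$, $|q_1|>|q_2|$, and put $\gamma=\frac{\log|q_2|}{\log|q_1|}$. Let $P(z)\in\mathbb Q[z]$ with $d:=\deg P\ge 1$ and $P(q^n)\ne 0$ for all $n\in\mathbb Z_{>0}$, and let $$f(z)=\sum_{n=0}^\infty\frac{z^n}{\prod_{k=1}^nP(q^k)}.$$ Let $m\in\mathbb Z_{>0}$ and let $\alpha_1,\ldots,\alpha_m\in\mathbb Q^*$ be such that 1. $\alpha_j\alpha_k^{-1}\notin q^{\mathbb Z}$ for all $j\ne k$; 2. $\alpha_j\notin P(0)q^{\mathbb Z_{>0}}$ for all $j$. Let $s_1,\ldots,s_m\in\mathbb Z_{>0}$, put $S=s_1+\ldots+s_m$ and $$M=\begin{cases} dS+\frac12+\sqrt{d^2S^2+\frac14}, & \text{if } P(z)=p_dz^d \text{ for some } p_d\in\mathbb Q^*,\\ dS+1+\sqrt{dS(dS+1)} & \text{otherwise.}\end{cases}$$ Suppose that $\gamma<\frac1M$. Then the numbers $$1,\quad f^{(\sigma)}(\alpha_jq^k)\qquad(1\le j\le m,\ 0\le k<d,\ 0\le\sigma<s_j)$$ are linearly independent over $\mathbb Q$. Moreover, there exists a positive constant $C_0=C_0(q,P,m,\alpha_j,s_j)$ such that for any vector $\vec A=(A_0,A_{j,k,\sigma})\in\mathbb Z^{1+dS}\setminus\{\vec 0\}$ (indices $1\le j\le m$, $0\le k<d$, $0\le\sigma<s_j$)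 we have $$\left|A_0+\sum_{j=1}^m\sum_{k=0}^{d-1}\sum_{\sigma=0}^{s_j-1}A_{j,k,\sigma}f^{(\sigma)}(\alpha_jq^k)\right|\ge H^{-\mu-C_0/\sqrt{\log H}},$$ where $H=\max\left\{\max_{j,k,\sigma}|A_{j,k,\sigma}|,\,2\right\}$ and $\mu=\frac{M-1}{1-M\gamma}$.
   Context: Here $q^{\mathbb Z}=\{q^n:n\in\mathbb Z\}$ and $P(0)q^{\mathbb Z_{>0}}=\{P(0)q^n:n\in\mathbb Z_{>0}\}$; $f^{(\sigma)}$ is the $\sigma$-th derivative of $f$ (with $f^{(0)}=f$). Since $|q|>1$ and $\deg P\ge1$, the series $f$ defines an entire function. The notation $C_0(q,P,m,\alpha_j,s_j)$ means that $C_0$ depends only on $q$, $P$, $m$, $\alpha_1,\dots,\alpha_m$, $s_1,\dots,s_m$ (not on $\vec A$). Empty products equal $1$. *)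

theory Defs
  imports
    "HOL-Complex_Analysis.Complex_Analysis"
    "HOL-Computational_Algebra.Computational_Algebra"
begin

definition qexp_series :: "rat \<Rightarrow> rat poly \<Rightarrow> complex \<Rightarrow> complex" where
  "qexp_series q P z = (\<Sum>n. z ^ n / of_rat (\<Prod>k=1..n. poly P (q ^ k)))"

(* Linear independence over the rationals of an indexed family (not of its set of values):
   a family with a repeated member is dependent. *)
definition rat_lin_indep_family :: "'i set \<Rightarrow> ('i \<Rightarrow> complex) \<Rightarrow> bool" where
  "rat_lin_indep_family I x \<longleftrightarrow>
     (\<forall>J c. finite J \<and> J \<subseteq> I \<and> (\<Sum>i\<in>J. of_rat (c i) * x i) = 0 \<longrightarrow> (\<forall>i\<in>J. c i = 0))"

end

theory Submission
  imports Defs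
begin

text \<open>
  Write \<open>E\<close> for the shift of sequences and \<open>\<P_prod>\<^sub>n\<close> for the product of the \<open>P(q^k)\<close>, \<open>1 \<le> k \<le> n\<close>.
  A linear form \<open>\<Lambda>\<close> in the values of \<open>f\<close> equals \<open>A\<^sub>0 + \<Sum> u\<^sub>n / \<P_prod>\<^sub>n\<close>, where \<open>u\<close> is an exponential
  polynomial with characteristic roots \<open>\<alpha>\<^sub>j q^k\<close>, \<open>0 \<le> k < d\<close>, of multiplicity \<open>s\<^sub>j\<close>. The truncated
  numerators \<open>v\<^sub>n = \<P_prod>\<^sub>n (A\<^sub>0 + \<Sum>\<^bsub>l\<le>n\<^esub> u\<^sub>l / \<P_prod>\<^sub>l)\<close> satisfy \<open>v\<^sub>n = P(q^n) v\<^sub>n\<^sub>-\<^sub>1 + u\<^sub>n\<close>, and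
  \<open>v\<^sub>n - \<Lambda> \<P_prod>\<^sub>n\<close> expands into exponentials with characteristic roots \<open>\<alpha>\<^sub>j q^-r\<close>, \<open>r \<ge> 1\<close>. Apply the operator
  \<open>T\<^sub>R(E)\<close>, where \<open>T\<^sub>R\<close> is the product of \<open>(x - \<alpha>\<^sub>j q^-r)^s\<^sub>j\<close> over \<open>1 \<le> r \<le> R\<close>, and evaluate at
  \<open>N \<approx> \<tau> R\<close>: it kills the first \<open>R\<close> levels of the tail, so that \<open>(T\<^sub>R v)\<^sub>N\<close> is small if \<open>\<Lambda>\<close> is, while it is a
  rational number with controlled denominator. The logarithms of all estimates are quadratic in \<open>R\<close> up
  to \<open>O(R)\<close>, and the optimal \<open>\<tau>\<close> produces \<open>M\<close>.

  Nonvanishing: \<open>T\<^sub>R v\<close> satisfies a homogeneous recurrence of order \<open>d S + 1\<close>, so it is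
  nonzero somewhere in each window of that length unless it vanishes from some point on. In that case \<open>v\<close>
  is an exponential polynomial with roots \<open>\<alpha>\<^sub>j q^-r\<close>, and comparing the lowest levels in
  \<open>v\<^sub>n - P(q^n) v\<^sub>n\<^sub>-\<^sub>1 = u\<^sub>n\<close> forces \<open>\<alpha>\<^sub>j = P(0) q^r\<close>, which is excluded.
\<close>

section \<open>Polynomials in the shift operator\<close>

text \<open>This is \<open>p(E) v\<close> for the shift \<open>E\<close>. Sequences thereby form a
  module over the polynomials, so that recurrences and annihilators can be handled by
  divisibility.\<close>

definition shift_op :: "'a::comm_ring_1 poly \<Rightarrow> (nat \<Rightarrow> 'a) \<Rightarrow> nat \<Rightarrow> 'a" where
  "shift_op p v n = (\<Sum>i\<le>degree p. coeff p i * v (n + i))"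

lemma shift_op_altdef:
  assumes "degree p \<le> k"
  shows "shift_op p v n = (\<Sum>i\<le>k. coeff p i * v (n + i))"
  unfolding shift_op_def
  by (rule sum.mono_neutral_left) (use assms in \<open>auto simp: coeff_eq_0\<close>)

lemma shift_op_0 [simp]: "shift_op 0 v n = 0"
  by (simp add: shift_op_def)

lemma shift_op_pCons [simp]: "shift_op (pCons a p) v n = a * v n + shift_op p v (Suc n)"
proof -
  have "shift_op (pCons a p) v n = (\<Sum>i\<le>Suc (degree p). coeff (pCons a p) i * v (n + i))"
    by (rule shift_op_altdef) (simp add: degree_pCons_le)
  also have "\<dots> = a * v n + (\<Sum>i\<le>degree p. coeff p i * v (Suc n + i))"
    by (subst sum.atMost_Suc_shift) simp
  finally show ?thesis by (simp add: shift_op_def)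
qed

lemma shift_op_add: "shift_op (p + r) v n = shift_op p v n + shift_op r v n"
proof -
  define k where "k = max (degree p) (degree r)"
  have "degree (p + r) \<le> k" "degree p \<le> k" "degree r \<le> k"
    using degree_add_le_max[of p r] by (auto simp: k_def)
  then show ?thesis
    by (simp add: shift_op_altdef[of _ k] sum.distrib algebra_simps)
qed

lemma shift_op_smult: "shift_op (smult c p) v n = c * shift_op p v n"
  by (subst shift_op_altdef[of _ "degree p"])
     (auto simp: degree_smult_le shift_op_def sum_distrib_left mult_ac)

lemma shift_op_mult: "shift_op (p * r) v n = shift_op p (shift_op r v) n"
  by (induction p arbitrary: n) (simp_all add: shift_op_add shift_op_smult)

text \<open>Conjugating the shift by multiplication with \<open>t ^ n\<close> turns \<open>E\<close>
  into \<open>t E\<close>. This is how operators are moved past the powers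
  \<open>q ^ (i * n)\<close> that \<open>P (q ^ n)\<close> contributes to a recurrence.\<close>

lemma shift_op_scale:
  "shift_op p (\<lambda>n. t ^ n * v n) n = t ^ n * shift_op (pcompose p [:0, t:]) v n"
  by (induction p arbitrary: n)
     (simp_all add: pcompose_pCons shift_op_add shift_op_smult algebra_simps)

lemma shift_op_shift: "shift_op p (\<lambda>n. v (n + l)) n = shift_op p v (n + l)"
  by (simp add: shift_op_def algebra_simps)

lemma shift_op_cmult: "shift_op p (\<lambda>n. c * v n) n = c * shift_op p v n"
  by (simp add: shift_op_def sum_distrib_left mult_ac)

lemma shift_op_seq_add: "shift_op p (\<lambda>n. v n + w n) n = shift_op p v n + shift_op p w n"
  by (simp add: shift_op_def sum.distrib algebra_simps)

lemma shift_op_seq_diff: "shift_op p (\<lambda>n. v n - w n) n = shift_op p v n - shift_op p w n"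
  by (simp add: shift_op_def sum_subtractf algebra_simps)

lemma shift_op_seq_sum: "shift_op p (\<lambda>n. \<Sum>x\<in>X. v x n) n = (\<Sum>x\<in>X. shift_op p (v x) n)"
  unfolding shift_op_def by (subst sum.swap) (simp add: sum_distrib_left)

lemma shift_op_eq_0:
  "(\<And>i. n \<le> i \<Longrightarrow> v i = 0) \<Longrightarrow> shift_op p v n = 0"
  by (simp add: shift_op_def)

lemma shift_op_sums:
  fixes v :: "nat \<Rightarrow> nat \<Rightarrow> complex"
  assumes "\<And>i. n \<le> i \<Longrightarrow> (\<lambda>l. v l i) sums w i"
  shows "(\<lambda>l. shift_op p (v l) n) sums shift_op p w n"
  unfolding shift_op_def by (intro sums_sum sums_mult assms) simp

lemma shift_op_geometric:
  assumes "\<And>n. N \<le> n \<Longrightarrow> v (Suc n) = c * v n" "N \<le> n"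
  shows "shift_op p v n = poly p c * v n"
  using assms(2)
  by (induction p arbitrary: n) (simp_all add: assms(1) algebra_simps)

section \<open>Exponential polynomials and the operators that annihilate them\<close>

definition binom_exp :: "'a::comm_ring_1 \<Rightarrow> nat \<Rightarrow> nat \<Rightarrow> 'a" where
  "binom_exp \<beta> \<sigma> n = of_nat (n choose \<sigma>) * \<beta> ^ (n - \<sigma>)"

lemma coeff_linear_power_eq_binom_exp: "coeff ([:\<beta>, 1:] ^ n) \<sigma> = binom_exp \<beta> \<sigma> n"
proof (cases "\<sigma> \<le> n")
  case False
  then have "degree ([:\<beta>, 1:] ^ n) < \<sigma>"
    using degree_power_le[of "[:\<beta>, 1:]" n] by simp
  then show ?thesis using False by (simp add: coeff_eq_0 binom_exp_def binomial_eq_0)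
qed (simp add: coeff_linear_poly_power binom_exp_def)

text \<open>By the previous lemma \<open>binom_exp \<beta> \<sigma> n\<close> is a coefficient of
  \<open>(\<beta> + x)^n\<close>. The shift multiplies this power by \<open>\<beta> + x\<close>,
  hence \<open>p(E)\<close> multiplies it by \<open>p(\<beta> + x)\<close>, and annihilation becomes
  the vanishing of low coefficients.\<close>

lemma shift_op_binom_exp:
  "shift_op p (binom_exp \<beta> \<sigma>) n = coeff ([:\<beta>, 1:] ^ n * pcompose p [:\<beta>, 1:]) \<sigma>"
proof (induction p arbitrary: n)
  case (pCons a p)
  then show ?case
    by (simp add: pcompose_pCons distrib_left coeff_linear_power_eq_binom_exp mult_ac)
qed simp

lemma pcompose_power: "pcompose (p ^ n) (r :: 'a::comm_ring_1 poly) = pcompose p r ^ n"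
  by (induction n) (simp_all add: pcompose_mult pcompose_1)

lemma pcompose_root_power: "pcompose ([:-\<beta>, 1:] ^ a) [:\<beta>, 1:] = monom (1::'a::comm_ring_1) a"
  by (simp add: pcompose_power pcompose_pCons monom_altdef)

text \<open>The factor \<open>(x - \<beta>)^a\<close> turns into \<open>x^a\<close> under the
  substitution, and a multiple of \<open>x^a\<close> has no coefficient below index
  \<open>a\<close>.\<close>

lemma shift_op_root_power_less:
  assumes "[:-\<beta>, 1:] ^ a dvd p" "\<sigma> < a"
  shows "shift_op p (binom_exp \<beta> \<sigma>) n = 0"
proof -
  obtain r where "p = [:-\<beta>, 1:] ^ a * r" using assms(1) by (elim dvdE)
  then have "shift_op p (binom_exp \<beta> \<sigma>) n =
      coeff (monom 1 a * ([:\<beta>, 1:] ^ n * pcompose r [:\<beta>, 1:])) \<sigma>"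
    by (simp add: shift_op_binom_exp pcompose_mult pcompose_root_power mult_ac)
  also have "\<dots> = 0" using assms(2) by (simp only: coeff_monom_mult) simp
  finally show ?thesis .
qed

text \<open>At the exact order only the constant coefficient of the cofactor survives. This isolates
  a single coefficient of \<open>u\<close> in the independence argument.\<close>

lemma shift_op_root_power_eq:
  "shift_op ([:-\<beta>, 1:] ^ \<sigma> * r) (binom_exp \<beta> \<sigma>) n = poly r \<beta> * \<beta> ^ n"
proof -
  have "shift_op ([:-\<beta>, 1:] ^ \<sigma> * r) (binom_exp \<beta> \<sigma>) n =
      coeff (monom 1 \<sigma> * ([:\<beta>, 1:] ^ n * pcompose r [:\<beta>, 1:])) \<sigma>"
    by (simp add: shift_op_binom_exp pcompose_mult pcompose_root_power mult_ac)
  also have "\<dots> = coeff ([:\<beta>, 1:] ^ n * pcompose r [:\<beta>, 1:]) 0"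
    by (simp only: coeff_monom_mult) simp
  also have "\<dots> = poly r \<beta> * \<beta> ^ n"
    by (simp flip: poly_0_coeff_0 add: poly_pcompose)
  finally show ?thesis .
qed

section \<open>A submultiplicative coefficient norm and the operator bound that it gives\<close>

definition pnorm :: "complex poly \<Rightarrow> real" where
  "pnorm p = sum_list (map norm (coeffs p))"

lemma pnorm_0 [simp]: "pnorm 0 = 0" by (simp add: pnorm_def)

lemma pnorm_pCons [simp]: "pnorm (pCons a p) = norm a + pnorm p"
  by (cases "a = 0 \<and> p = 0") (auto simp: pnorm_def cCons_def)

lemma pnorm_1 [simp]: "pnorm 1 = 1" by (simp add: one_pCons)

lemma pnorm_nonneg [simp]: "pnorm p \<ge> 0"
  by (induction p) simp_all

lemma pnorm_add: "pnorm (p + r) \<le> pnorm p + pnorm r"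
proof (induction p r rule: poly_induct2)
  case (pCons a p b r)
  then show ?case using norm_triangle_ineq[of a b] by simp
qed simp

lemma pnorm_smult: "pnorm (smult c p) = norm c * pnorm p"
  by (induction p) (simp_all add: norm_mult distrib_left)

lemma pnorm_mult: "pnorm (p * r) \<le> pnorm p * pnorm r"
proof (induction p)
  case (pCons a p)
  have "pnorm (pCons a p * r) \<le> norm a * pnorm r + pnorm (p * r)"
    using pnorm_add[of "smult a r" "pCons 0 (p * r)"] by (simp add: pnorm_smult)
  with pCons show ?case by (simp add: distrib_right)
qed simp

lemma pnorm_power: "pnorm (p ^ n) \<le> pnorm p ^ n"
  by (induction n) (auto intro!: order_trans[OF pnorm_mult] mult_left_mono)

lemma pnorm_prod: "pnorm (\<Prod>x\<in>X. p x) \<le> (\<Prod>x\<in>X. pnorm (p x))"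
  by (induction X rule: infinite_finite_induct)
     (auto intro!: order_trans[OF pnorm_mult] mult_left_mono)

lemma norm_coeff_le_pnorm: "norm (coeff p i) \<le> pnorm p"
proof (induction p arbitrary: i)
  case (pCons a p)
  show ?case by (cases i) (auto intro: order_trans[OF pCons.IH])
qed simp

lemma norm_shift_op_le:
  assumes "\<And>i. i \<le> degree p \<Longrightarrow> norm (v (n + i)) \<le> B"
  shows "norm (shift_op p v n) \<le> pnorm p * B"
  using assms
proof (induction p arbitrary: n)
  case (pCons a p)
  have 1: "norm (v n) \<le> B" using pCons.prems[of 0] by simp
  have 2: "norm (shift_op p v (Suc n)) \<le> pnorm p * B"
  proof (cases "p = 0")
    case False
    then show ?thesis by (intro pCons.IH) (use pCons.prems[of "Suc _"] in auto)
  qed simp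
  have "norm (shift_op (pCons a p) v n) \<le> norm a * norm (v n) + norm (shift_op p v (Suc n))"
    using norm_triangle_ineq[of "a * v n" "shift_op p v (Suc n)"] by (simp add: norm_mult)
  also have "\<dots> \<le> norm a * B + pnorm p * B"
    by (intro add_mono mult_left_mono 1 2) auto
  finally show ?case by (simp add: distrib_right)
qed simp

section \<open>Nonvanishing\<close>

text \<open>Nonvanishing and the upper estimates work over the complex numbers; rationality enters
  only in an extension of this locale. In \<open>\<alpha>_ratio\<close> two natural exponents
  express an arbitrary integer power of \<open>q\<close>.\<close>

locale q_system =
  fixes q :: complex and P :: "complex poly" and d m :: nat
    and \<alpha> :: "nat \<Rightarrow> complex" and s :: "nat \<Rightarrow> nat"
  assumes norm_q: "norm q > 1"
    and d_def: "d = degree P" and d_pos: "d \<ge> 1"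
    and P_nz: "n > 0 \<Longrightarrow> poly P (q ^ n) \<noteq> 0"
    and \<alpha>_nz: "j \<in> {1..m} \<Longrightarrow> \<alpha> j \<noteq> 0"
    and \<alpha>_ratio: "j \<in> {1..m} \<Longrightarrow> k \<in> {1..m} \<Longrightarrow> \<alpha> j * q ^ a = \<alpha> k * q ^ b \<Longrightarrow> j = k"
    and \<alpha>_P0: "j \<in> {1..m} \<Longrightarrow> n > 0 \<Longrightarrow> \<alpha> j \<noteq> poly P 0 * q ^ n"
begin

definition S :: nat where "S = (\<Sum>j=1..m. s j)"

definition block :: "complex \<Rightarrow> complex poly" where
  "block c = (\<Prod>j=1..m. [:- (\<alpha> j * c), 1:] ^ s j)"

text \<open>Integer levels put the annihilator of \<open>u\<close> (levels \<open>0\<close> to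
  \<open>d - 1\<close>) and \<open>T R\<close> (levels \<open>- R\<close> to \<open>- 1\<close>)
  into one family, on which scaling by a power of \<open>q\<close> acts as a translation.\<close>

definition levels :: "int \<Rightarrow> int \<Rightarrow> complex poly" where
  "levels a b = (\<Prod>r\<in>{a..<b}. block (q powi r))"

definition idx :: "(nat \<times> nat \<times> nat) set" where
  "idx = (SIGMA j:{1..m}. SIGMA k:{..<d}. {..<s j})"

text \<open>Since \<open>fact \<sigma> * binom_exp z \<sigma> n\<close> is the
  \<open>\<sigma>\<close>-th derivative of \<open>z ^ n\<close>, this is the numerator of the
  \<open>n\<close>-th term of the linear form without its constant term.\<close>

definition u :: "(nat \<times> nat \<times> nat \<Rightarrow> complex) \<Rightarrow> nat \<Rightarrow> complex" where
  "u A n = (\<Sum>(j, k, \<sigma>)\<in>idx. A (j, k, \<sigma>) * fact \<sigma> * binom_exp (\<alpha> j * q ^ k) \<sigma> n)"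

primrec v :: "complex \<Rightarrow> (nat \<times> nat \<times> nat \<Rightarrow> complex) \<Rightarrow> nat \<Rightarrow> complex" where
  "v A0 A 0 = A0 + u A 0"
| "v A0 A (Suc n) = poly P (q ^ Suc n) * v A0 A n + u A (Suc n)"

abbreviation T :: "nat \<Rightarrow> complex poly" where "T R \<equiv> levels (- int R) 0"

lemma finite_idx [simp]: "finite idx"
  by (auto simp: idx_def)

lemma idx_iff [simp]: "(j, k, \<sigma>) \<in> idx \<longleftrightarrow> j \<in> {1..m} \<and> k < d \<and> \<sigma> < s j"
  by (auto simp: idx_def)

lemma q_nz [simp]: "q \<noteq> 0"
  using norm_q by auto

lemma q_power_neq_1: "n > 0 \<Longrightarrow> q ^ n \<noteq> 1"
  using one_less_power[OF norm_q, of n] by (metis less_irrefl norm_one norm_power)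

lemma block_monic [simp]: "lead_coeff (block c) = 1"
  by (simp add: block_def lead_coeff_prod lead_coeff_power del: One_nat_def)

lemma block_nz [simp]: "block c \<noteq> 0"
  using block_monic[of c] by (metis leading_coeff_0_iff zero_neq_one)

lemma degree_block [simp]: "degree (block c) = S"
  unfolding block_def S_def
  by (subst degree_prod_eq_sum_degree) (auto simp: degree_power_eq del: One_nat_def)

lemma levels_monic [simp]: "lead_coeff (levels a b) = 1"
  unfolding levels_def lead_coeff_prod by (simp only: block_monic prod.neutral_const)

lemma levels_nz [simp]: "levels a b \<noteq> 0"
  using levels_monic[of a b] by (metis leading_coeff_0_iff zero_neq_one)

lemma degree_levels [simp]: "degree (levels a b) = nat (b - a) * S"
  unfolding levels_def by (subst degree_prod_eq_sum_degree) auto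

lemma poly_levels_eq_0_iff:
  "poly (levels a b) x = 0 \<longleftrightarrow> (\<exists>r\<in>{a..<b}. \<exists>j\<in>{1..m}. s j > 0 \<and> x = \<alpha> j * q powi r)"
  by (auto simp: levels_def block_def poly_prod poly_power)

lemma pcompose_block:
  assumes "t \<noteq> 0"
  shows "pcompose (block c) [:0, t:] = smult (t ^ S) (block (c / t))"
proof -
  have "pcompose (block c) [:0, t:] = (\<Prod>j=1..m. smult (t ^ s j) ([:- (\<alpha> j * (c / t)), 1:] ^ s j))"
    unfolding block_def pcompose_prod
    by (intro prod.cong refl)
       (simp add: pcompose_power pcompose_pCons assms flip: smult_power)
  also have "\<dots> = smult (t ^ S) (block (c / t))"
    by (simp add: prod_smult block_def S_def power_sum)
  finally show ?thesis .
qed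

text \<open>Substituting \<open>q powi i\<close> times the variable divides every root by
  \<open>q powi i\<close>, which lowers each level by \<open>i\<close>; the scalar comes from
  keeping the factors monic.\<close>

lemma pcompose_levels:
  "pcompose (levels a b) [:0, q powi i:] =
     smult ((q powi i) ^ (S * nat (b - a))) (levels (a - i) (b - i))"
proof -
  have "pcompose (levels a b) [:0, q powi i:] =
      (\<Prod>r\<in>{a..<b}. smult ((q powi i) ^ S) (block (q powi (r - i))))"
    unfolding levels_def pcompose_prod
    by (intro prod.cong refl) (simp add: pcompose_block power_int_diff)
  also have "\<dots> = smult ((q powi i) ^ (S * nat (b - a))) (\<Prod>r\<in>{a..<b}. block (q powi (r - i)))"
    by (simp add: prod_smult power_mult)
  also have "(\<Prod>r\<in>{a..<b}. block (q powi (r - i))) = levels (a - i) (b - i)"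
    unfolding levels_def
    by (rule prod.reindex_bij_witness[of _ "\<lambda>r. r + i" "\<lambda>r. r - i"]) auto
  finally show ?thesis .
qed

lemma levels_dvd: "a' \<le> a \<Longrightarrow> b \<le> b' \<Longrightarrow> levels a b dvd levels a' b'"
  unfolding levels_def by (intro prod_dvd_prod_subset) auto

lemma root_power_dvd_levels:
  assumes "j \<in> {1..m}" "r \<in> {a..<b}"
  shows "[:- (\<alpha> j * q powi r), 1:] ^ s j dvd levels a b"
proof -
  have "[:- (\<alpha> j * q powi r), 1:] ^ s j dvd block (q powi r)"
    unfolding block_def by (rule dvd_prodI) (use assms in auto)
  also have "\<dots> dvd levels a b"
    unfolding levels_def by (rule dvd_prodI) (use assms in auto)
  finally show ?thesis .
qed

lemma shift_op_u: "shift_op p (u A) n =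
    (\<Sum>(j, k, \<sigma>)\<in>idx. A (j, k, \<sigma>) * fact \<sigma> * shift_op p (binom_exp (\<alpha> j * q ^ k) \<sigma>) n)"
  unfolding u_def shift_op_seq_sum
  by (intro sum.cong refl) (simp add: case_prod_unfold shift_op_cmult)

lemma shift_op_u_eq_0:
  assumes "levels 0 (int d) dvd p"
  shows "shift_op p (u A) n = 0"
proof -
  have "shift_op p (binom_exp (\<alpha> j * q ^ k) \<sigma>) n = 0" if "(j, k, \<sigma>) \<in> idx" for j k \<sigma>
    using root_power_dvd_levels[of j "int k" 0 "int d"] that assms
    by (intro shift_op_root_power_less[of _ "s j"]) (auto intro: dvd_trans)
  then show ?thesis
    by (auto simp: shift_op_u intro!: sum.neutral)
qed

lemma poly_P_altdef: "poly P x = (\<Sum>i\<le>d. coeff P i * x ^ i)"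
  by (simp add: poly_altdef d_def)

text \<open>The monomials of \<open>P (q ^ n)\<close> are geometric weights, past which
  \<open>p\<close> is moved by \<open>shift_op_scale\<close>; the inhomogeneity \<open>u\<close>
  disappears because \<open>p\<close> contains its annihilator.\<close>

lemma shift_op_v_Suc:
  assumes "levels 0 (int d) dvd p"
  shows "shift_op p (v A0 A) (Suc n) =
    (\<Sum>i\<le>d. coeff P i * q ^ (i * Suc n) * shift_op (pcompose p [:0, q ^ i:]) (v A0 A) n)"
proof -
  have "v A0 A (Suc n) = (\<Sum>i\<le>d. coeff P i * q ^ i * ((q ^ i) ^ n * v A0 A n)) + u A (n + 1)" for n
  proof -
    have "(q ^ Suc n) ^ i = q ^ i * (q ^ i) ^ n" for i
      by (metis power_Suc power_commutes power_mult mult.commute)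
    then show ?thesis
      by (simp add: poly_P_altdef sum_distrib_left mult_ac del: power_Suc)
  qed
  then have "shift_op p (v A0 A) (Suc n) =
      shift_op p (\<lambda>n. (\<Sum>i\<le>d. coeff P i * q ^ i * ((q ^ i) ^ n * v A0 A n)) + u A (n + 1)) n"
    using shift_op_shift[of p "v A0 A" 1 n] by simp
  also have "\<dots> = (\<Sum>i\<le>d. coeff P i * q ^ i * ((q ^ i) ^ n * shift_op (pcompose p [:0, q ^ i:]) (v A0 A) n))
      + shift_op p (u A) (n + 1)"
    by (simp only: shift_op_seq_add shift_op_seq_sum shift_op_cmult shift_op_scale shift_op_shift)
  also have "shift_op p (u A) (n + 1) = 0"
    by (rule shift_op_u_eq_0[OF assms])
  finally show ?thesis
    by (simp add: mult_ac power_add flip: power_mult)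
qed

text \<open>
  Applying \<open>levels (-R) d\<close> to the recurrence of \<open>v\<close> kills \<open>u\<close>; commuting it past \<open>q^(i n)\<close> shifts the
  levels down by \<open>i \<le> d\<close>, so \<open>T R\<close> remains a factor throughout.
\<close>

lemma shift_op_T_v_zero_forward:
  assumes zero: "\<And>n. N \<le> n \<Longrightarrow> n \<le> N + d * S \<Longrightarrow> shift_op (T R) (v A0 A) n = 0"
    and "N \<le> n"
  shows "shift_op (T R) (v A0 A) n = 0"
proof -
  define w where "w = shift_op (T R) (v A0 A)"
  define B where "B = levels (- int R) (int d)"
  \<comment> \<open>Scaling by \<open>q ^ i\<close> moves the levels of \<open>B\<close> to the
    range from \<open>- R - i\<close> to \<open>d - i - 1\<close>. As \<open>i \<le> d\<close>, this
    contains the levels of \<open>T R\<close>, and \<open>d\<close> levels are left for the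
    quotient.\<close>
  have "\<exists>U. pcompose B [:0, q ^ i:] = U * T R \<and> degree U = d * S" if "i \<le> d" for i
  proof -
    have "T R dvd pcompose B [:0, q ^ i:]"
      unfolding B_def pcompose_levels[of _ _ "int i", simplified]
      by (rule dvd_smult, rule levels_dvd) (use that in auto)
    then obtain U where U: "pcompose B [:0, q ^ i:] = U * T R" by (metis dvdE mult.commute)
    have "degree (pcompose B [:0, q ^ i:]) = (R + d) * S"
      by (simp add: B_def degree_pcompose nat_add_distrib add.commute)
    moreover have "U \<noteq> 0"
      using U pcompose_levels[of _ _ "int i"] by (auto simp: B_def)
    ultimately have "degree U + R * S = (R + d) * S"
      unfolding U by (subst (asm) degree_mult_eq) auto
    with U show ?thesis by (auto simp: algebra_simps)
  qed
  then obtain U where U: "\<And>i. i \<le> d \<Longrightarrow> pcompose B [:0, q ^ i:] = U i * T R"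
      and deg_U: "\<And>i. i \<le> d \<Longrightarrow> degree (U i) = d * S" by metis
  have B_eq: "B = U 0 * T R" using U[of 0] by simp
  then have lc: "lead_coeff (U 0) = 1"
    using levels_monic[of "- int R" "int d"] levels_monic[of "- int R" 0]
    by (metis B_def lead_coeff_mult mult.right_neutral)
  \<comment> \<open>A scalar recurrence for \<open>w\<close> remains: the monic \<open>U 0\<close>
    acts at \<open>Suc n\<close> and all \<open>U i\<close> on the right act at \<open>n\<close>, so
    \<open>d * S + 1\<close> consecutive zeros force the next one.\<close>
  have rec: "shift_op (U 0) w (Suc n) = (\<Sum>i\<le>d. coeff P i * q ^ (i * Suc n) * shift_op (U i) w n)" for n
  proof -
    have "levels 0 (int d) dvd B" unfolding B_def by (rule levels_dvd) auto
    from shift_op_v_Suc[OF this, of A0 A n] show ?thesis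
      unfolding w_def shift_op_mult[symmetric] B_eq[symmetric] by (simp add: U)
  qed
  have "w n = 0" if "N \<le> n" for n
    using that
  proof (induction n rule: less_induct)
    case (less n)
    show ?case
    proof (cases "n \<le> N + d * S")
      case True
      then show ?thesis using zero less.prems by (simp add: w_def)
    next
      case False
      \<comment> \<open>With this \<open>k\<close> the leading term of \<open>U 0\<close> at
        \<open>Suc k\<close> is exactly \<open>w n\<close>, and all other indices involved lie
        between \<open>k\<close> and \<open>k + d * S\<close>, hence below \<open>n\<close>.\<close>
      define k where "k = n - Suc (d * S)"
      have k: "n = Suc k + d * S" "N \<le> k" using False by (auto simp: k_def)
      have small: "w (k + i) = 0" if "i \<le> d * S" for i
        by (rule less.IH) (use that k in auto)
      have "shift_op (U i) w k = 0" if "i \<le> d" for i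
        using that by (simp add: shift_op_def deg_U small)
      then have "0 = shift_op (U 0) w (Suc k)" by (simp add: rec)
      also have "\<dots> = (\<Sum>i<d * S. coeff (U 0) i * w (k + Suc i)) + w n"
        using lc k(1) by (simp add: shift_op_def deg_U lessThan_Suc_atMost[symmetric])
      also have "(\<Sum>i<d * S. coeff (U 0) i * w (k + Suc i)) = 0"
        by (intro sum.neutral) (auto simp: small simp del: add_Suc_right)
      finally show ?thesis by simp
    qed
  qed
  with assms(2) show ?thesis by (simp add: w_def)
qed

text \<open>
  For a root \<open>\<rho>\<close> of least modulus of a minimal annihilator \<open>p\<close>, no \<open>\<rho> / q^i\<close> is a root. Hence all terms
  with \<open>i \<ge> 1\<close> of the recurrence can be annihilated while keeping the eigenvector \<open>p' v\<close> of \<open>\<rho>\<close>, which then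
  is also an eigenvector of \<open>P(0)\<close>.
\<close>

lemma v_eventually_zero:
  assumes zero: "\<And>n. N \<le> n \<Longrightarrow> shift_op (T R) (v A0 A) n = 0" and "N \<le> n"
  shows "v A0 A n = 0"
proof -
  let ?v = "v A0 A"
  define Q where "Q = (\<lambda> p. p dvd T R \<and> (\<forall>n\<ge>N. shift_op p ?v n = 0))"
  have "Q (T R)" using zero by (simp add: Q_def)
  then obtain p where p: "Q p" and min: "\<And>p'. Q p' \<Longrightarrow> degree p \<le> degree p'"
    using ex_has_least_nat[of Q "T R" degree] by blast
  have p_dvd: "p dvd T R" and p0: "\<And>n. n \<ge> N \<Longrightarrow> shift_op p ?v n = 0"
    using p by (auto simp: Q_def)
  have "p \<noteq> 0" using p_dvd by auto
  show ?thesis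
  proof (cases "degree p = 0")
    case True
    then obtain c where "p = [:c:]" by (metis degree_eq_zeroE)
    then show ?thesis using p0[OF assms(2)] \<open>p \<noteq> 0\<close> by auto
  next
    case False
    define Z where "Z = {x. poly p x = 0}"
    have "finite Z" unfolding Z_def using \<open>p \<noteq> 0\<close> by (rule poly_roots_finite)
    moreover have "Z \<noteq> {}"
      using False fundamental_theorem_of_algebra[of p] by (auto simp: Z_def constant_degree)
    ultimately obtain \<rho> where \<rho>: "\<rho> \<in> Z" and \<rho>_min: "\<And>x. x \<in> Z \<Longrightarrow> norm \<rho> \<le> norm x"
      using arg_min_if_finite[of Z norm] by (metis linorder_not_less)
    obtain p' where p': "p = [:-\<rho>, 1:] * p'"
      using \<rho> by (auto simp: Z_def poly_eq_0_iff_dvd elim: dvdE)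
    have "poly (T R) \<rho> = 0"
      using p_dvd \<rho> by (auto simp: Z_def elim!: dvdE)
    then obtain r j where r: "r < 0" and j: "j \<in> {1..m}" and \<rho>_eq: "\<rho> = \<alpha> j * q powi r"
      unfolding poly_levels_eq_0_iff by auto
    define r' where "r' = nat (- r)"
    have r': "r = - int r'" "r' > 0" using r by (auto simp: r'_def)
    have \<alpha>_eq: "\<alpha> j = \<rho> * q ^ r'"
      by (simp add: \<rho>_eq r' power_int_minus)
    have "\<rho> \<noteq> 0" using \<alpha>_eq \<alpha>_nz[OF j] by auto
    \<comment> \<open>The factor \<open>p (x / q ^ i)\<close> becomes \<open>p\<close> under scaling
      by \<open>q ^ i\<close> and so kills the \<open>i\<close>-th term of the recurrence; the
      levels \<open>0\<close> to \<open>d - 1\<close> kill \<open>u\<close>. None of these factors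
      vanishes at \<open>\<rho>\<close>, as shown next.\<close>
    define C where "C = (\<Prod>i=1..d. pcompose p [:0, 1 / q ^ i:]) * levels 0 (int d)"
    have "poly p (\<rho> / q ^ i) \<noteq> 0" if "i \<ge> 1" for i
    proof
      assume "poly p (\<rho> / q ^ i) = 0"
      then have "norm \<rho> \<le> norm (\<rho> / q ^ i)" by (intro \<rho>_min) (simp add: Z_def)
      moreover have "norm q ^ i > 1" using that norm_q by (intro one_less_power) auto
      ultimately show False using \<open>\<rho> \<noteq> 0\<close>
        by (simp add: norm_divide norm_power field_simps mult_le_cancel_right1 split: if_splits)
    qed
    \<comment> \<open>\<open>\<rho>\<close> lies at a negative level. If it also lay at a level
      \<open>l \<ge> 0\<close>, then \<open>\<alpha>_ratio\<close> would give \<open>j = k\<close>,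
      and a positive power of \<open>q\<close> would equal 1.\<close>
    moreover have "poly (levels 0 (int d)) \<rho> \<noteq> 0"
    proof
      assume "poly (levels 0 (int d)) \<rho> = 0"
      then obtain l k where k: "k \<in> {1..m}" "\<rho> = \<alpha> k * q powi l" "l \<ge> 0"
        unfolding poly_levels_eq_0_iff by force
      have l: "\<rho> = \<alpha> k * q ^ nat l"
        using k by (simp add: power_int_def)
      then have eq: "\<alpha> j = \<alpha> k * q ^ (nat l + r')"
        by (simp add: \<alpha>_eq power_add)
      then have "j = k" using \<alpha>_ratio[OF j k(1), of 0 "nat l + r'"] by simp
      then show False using eq q_power_neq_1[of "nat l + r'"] \<alpha>_nz[OF j] r' by simp
    qed
    ultimately have C: "poly C \<rho> \<noteq> 0"
      by (auto simp: C_def poly_prod poly_pcompose)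
    define v' where "v' = shift_op p' ?v"
    have v'_Suc: "v' (Suc n) = \<rho> * v' n" if "N \<le> n" for n
    proof -
      have "shift_op [:-\<rho>, 1:] v' n = 0"
        using p0[OF that] unfolding p' shift_op_mult v'_def .
      then show ?thesis by simp
    qed
    have Cp': "shift_op (C * p') ?v n = poly C \<rho> * v' n" if "N \<le> n" for n
      using v'_Suc that unfolding shift_op_mult v'_def[symmetric] by (rule shift_op_geometric)
    \<comment> \<open>Only the term \<open>i = 0\<close> of the recurrence survives
      \<open>C * p'\<close>. Since \<open>C\<close> acts on \<open>v'\<close> as the nonzero scalar
      \<open>poly C \<rho>\<close>, the two sides compare the eigenvalues \<open>\<rho>\<close> and
      \<open>P(0)\<close>.\<close>
    have main: "(\<rho> - poly P 0) * v' n = 0" if "N \<le> n" for n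
    proof -
      have high: "shift_op (pcompose (C * p') [:0, q ^ i:]) ?v n = 0" if i: "i \<in> {1..d}" for i
      proof -
        have "pcompose p [:0, 1 / q ^ i:] dvd C * p'"
          unfolding C_def using i by (intro dvd_mult2 dvd_prodI) auto
        then obtain X where X: "C * p' = pcompose p [:0, 1 / q ^ i:] * X" by (elim dvdE)
        have "pcompose (C * p') [:0, q ^ i:] =
            pcompose (pcompose p [:0, 1 / q ^ i:]) [:0, q ^ i:] * pcompose X [:0, q ^ i:]"
          unfolding X pcompose_mult ..
        also have "pcompose (pcompose p [:0, 1 / q ^ i:]) [:0, q ^ i:] = p"
          by (simp add: pcompose_pCons flip: pcompose_assoc)
        finally have "pcompose (C * p') [:0, q ^ i:] = pcompose X [:0, q ^ i:] * p"
          by (simp add: mult.commute)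
        then show ?thesis
          using \<open>N \<le> n\<close> by (simp only: shift_op_mult) (rule shift_op_eq_0, simp add: p0)
      qed
      have "levels 0 (int d) dvd C * p'" by (simp add: C_def)
      then have "shift_op (C * p') ?v (Suc n) =
          (\<Sum>i\<le>d. coeff P i * q ^ (i * Suc n) * shift_op (pcompose (C * p') [:0, q ^ i:]) ?v n)"
        by (rule shift_op_v_Suc)
      also have "\<dots> = (\<Sum>i\<in>{0}. coeff P i * q ^ (i * Suc n) * shift_op (pcompose (C * p') [:0, q ^ i:]) ?v n)"
        by (rule sum.mono_neutral_right) (auto simp: high)
      also have "\<dots> = poly P 0 * shift_op (C * p') ?v n" by (simp add: poly_0_coeff_0)
      finally show ?thesis
        using that C by (simp add: Cp' v'_Suc algebra_simps)
    qed
    have "\<rho> \<noteq> poly P 0"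
      using \<alpha>_P0[OF j, of r'] r' \<alpha>_eq by auto
    moreover have "p' dvd T R"
      using p_dvd unfolding p' by (rule dvd_mult_right)
    \<comment> \<open>As \<open>\<rho>\<close> differs from \<open>P(0)\<close>, \<open>v'\<close>
      vanishes from \<open>N\<close> on. So \<open>p'\<close> is an annihilator of smaller degree,
      against the minimality of \<open>p\<close>.\<close>
    ultimately have "Q p'"
      using main by (auto simp: Q_def v'_def)
    from min[OF this] show ?thesis
      using \<open>p \<noteq> 0\<close> by (simp add: p' degree_mult_eq del: mult_pCons_left)
  qed
qed

text \<open>Exponentials with distinct roots are independent: at a root with a nonzero coefficient,
  take the highest order that occurs and apply an operator that kills every other term.\<close>

lemma u_eventually_zero_imp:
  assumes zero: "\<And>n. N \<le> n \<Longrightarrow> u A n = 0" and jk: "(j, k, \<sigma>) \<in> idx"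
  shows "A (j, k, \<sigma>) = 0"
proof (rule ccontr)
  assume nz: "A (j, k, \<sigma>) \<noteq> 0"
  define Z where "Z = {\<sigma>. (j, k, \<sigma>) \<in> idx \<and> A (j, k, \<sigma>) \<noteq> 0}"
  have fin: "finite Z" by (rule finite_subset[of _ "{..<s j}"]) (auto simp: Z_def)
  have "Z \<noteq> {}" using jk nz by (auto simp: Z_def)
  define \<sigma>0 where "\<sigma>0 = Max Z"
  have \<sigma>0: "\<sigma>0 \<in> Z" using Max_in fin \<open>Z \<noteq> {}\<close> by (simp add: \<sigma>0_def)
  define X where "X = {1..m} \<times> {..<d} - {(j, k)}"
  define C where "C = (\<Prod>(j', k')\<in>X. [:- (\<alpha> j' * q ^ k'), 1:] ^ s j')"
  \<comment> \<open>\<open>C\<close> kills the other roots to full multiplicity, and the power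
    \<open>\<sigma>0\<close> kills the lower orders at this root. Higher orders have coefficient
    zero by the choice of \<open>\<sigma>0\<close>.\<close>
  define p where "p = [:- (\<alpha> j * q ^ k), 1:] ^ \<sigma>0 * C"
  have "finite X" by (simp add: X_def)
  have inj: "(j', k') = (j, k)" if "j' \<in> {1..m}" "\<alpha> j' * q ^ k' = \<alpha> j * q ^ k" for j' k'
  proof -
    have "j' = j" using \<alpha>_ratio[of j' j k' k] that jk by auto
    then have "q ^ k' = q ^ k" using that \<alpha>_nz by auto
    then have "norm q ^ k' = norm q ^ k" by (metis norm_power)
    then show ?thesis using norm_q \<open>j' = j\<close> by simp
  qed
  have C: "poly C (\<alpha> j * q ^ k) \<noteq> 0"
    using \<open>finite X\<close> inj
    by (fastforce simp: C_def poly_prod poly_power case_prod_unfold X_def)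
  have "shift_op p (u A) N =
      (\<Sum>(j', k', \<sigma>')\<in>{(j, k, \<sigma>0)}. A (j', k', \<sigma>') * fact \<sigma>' * shift_op p (binom_exp (\<alpha> j' * q ^ k') \<sigma>') N)"
    unfolding shift_op_u
  proof (rule sum.mono_neutral_right, goal_cases)
    case 3
    have "A (j', k', \<sigma>') * shift_op p (binom_exp (\<alpha> j' * q ^ k') \<sigma>') N = 0"
      if i: "(j', k', \<sigma>') \<in> idx" and ne: "(j', k', \<sigma>') \<noteq> (j, k, \<sigma>0)" for j' k' \<sigma>'
    proof (cases "(j', k') = (j, k)")
      case False
      then have "[:- (\<alpha> j' * q ^ k'), 1:] ^ s j' dvd C"
        unfolding C_def using i \<open>finite X\<close>
          dvd_prodI[of X "(j', k')" "\<lambda>(j', k'). [:- (\<alpha> j' * q ^ k'), 1:] ^ s j'"]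
        by (auto simp: X_def)
      then have "shift_op p (binom_exp (\<alpha> j' * q ^ k') \<sigma>') N = 0"
        using i by (intro shift_op_root_power_less[of _ "s j'"]) (auto simp: p_def)
      then show ?thesis by simp
    next
      case True
      then have *: "\<sigma>' \<noteq> \<sigma>0" using ne by auto
      show ?thesis
      proof (cases "\<sigma>' < \<sigma>0")
        case True
        then have "shift_op p (binom_exp (\<alpha> j' * q ^ k') \<sigma>') N = 0"
          using \<open>(j', k') = (j, k)\<close>
          by (intro shift_op_root_power_less[of _ \<sigma>0]) (auto simp: p_def)
        then show ?thesis by simp
      next
        case False
        then have "\<sigma>' \<notin> Z" using * Max_ge[OF fin, of \<sigma>'] by (auto simp: \<sigma>0_def)
        then show ?thesis using i True by (auto simp: Z_def)
      qed
    qed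
    then show ?case by fastforce
  qed (use \<sigma>0 in \<open>auto simp: Z_def\<close>)
  also have "\<dots> = A (j, k, \<sigma>0) * fact \<sigma>0 * (poly C (\<alpha> j * q ^ k) * (\<alpha> j * q ^ k) ^ N)"
    by (simp add: p_def shift_op_root_power_eq)
  also have "\<dots> \<noteq> 0"
    using C \<sigma>0 \<alpha>_nz[of j] jk by (auto simp: Z_def)
  finally show False
    using shift_op_eq_0[of N "u A" p] zero by auto
qed

text \<open>Zeros on the whole window propagate to all later indices; then \<open>v\<close> vanishes
  eventually, hence so does \<open>u\<close>, which forces all coefficients on \<open>idx\<close>
  and finally \<open>A0\<close> to be zero.\<close>

lemma shift_op_T_v_nonzero:
  assumes "A0 \<noteq> 0 \<or> (\<exists>i\<in>idx. A i \<noteq> 0)"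
  shows "\<exists>n\<in>{N..N + d * S}. shift_op (T R) (v A0 A) n \<noteq> 0"
proof (rule ccontr)
  assume "\<not> ?thesis"
  then have "shift_op (T R) (v A0 A) n = 0" if "N \<le> n" for n
    using shift_op_T_v_zero_forward[of N R A0 A n] that by auto
  then have v0: "v A0 A n = 0" if "N \<le> n" for n
    using v_eventually_zero[of N R A0 A n] that by auto
  then have "u A n = 0" if "Suc N \<le> n" for n
    using that v0[of "n - 1"] v0[of n] by (cases n) auto
  then have A: "A i = 0" if "i \<in> idx" for i
    using u_eventually_zero_imp[of "Suc N" A] that by (cases i) auto
  then have u0: "u A n = 0" for n by (auto simp: u_def intro!: sum.neutral)
  \<comment> \<open>With \<open>u = 0\<close> the sequence \<open>v\<close> is \<open>A0\<close>
    times a product of the nonzero values \<open>P (q ^ k)\<close>.\<close>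
  have "v A0 A n \<noteq> 0" if "A0 \<noteq> 0" for n
    using that P_nz[of "Suc _"] by (induction n) (auto simp: u0 simp del: power_Suc)
  then show False using assms A v0[of N] by auto
qed

end

section \<open>Size and denominators\<close>

context q_system
begin

lemma norm_q_power: "norm q ^ n = exp (ln (norm q) * real n)"
  using norm_q by (simp add: exp_of_nat2_mult)

lemma T_Suc: "T (Suc R) = block (1 / q ^ Suc R) * T R"
proof -
  have "{- int (Suc R)..<0} = insert (- int (Suc R)) {- int R..<0}" by auto
  moreover have "q powi (- int (Suc R)) = 1 / q ^ Suc R"
    by (simp only: power_int_minus power_int_of_nat) (simp add: field_simps)
  ultimately show ?thesis
    unfolding levels_def by (simp del: of_nat_Suc power_Suc)
qed

lemma pnorm_block_le:
  assumes "\<And>j. j \<in> {1..m} \<Longrightarrow> norm b + norm (\<alpha> j * c) \<le> W"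
  shows "pnorm (\<Prod>j=1..m. [:- (\<alpha> j * c) , b:] ^ s j) \<le> W ^ S"
proof -
  have "pnorm (\<Prod>j=1..m. [:- (\<alpha> j * c), b:] ^ s j) \<le> (\<Prod>j=1..m. pnorm ([:- (\<alpha> j * c), b:] ^ s j))"
    by (rule pnorm_prod)
  also have "\<dots> \<le> (\<Prod>j=1..m. W ^ s j)"
    by (intro prod_mono conjI pnorm_nonneg order_trans[OF pnorm_power] power_mono)
       (use assms in \<open>auto simp: add.commute\<close>)
  finally show ?thesis by (simp add: S_def power_sum)
qed

definition P_prod :: "nat \<Rightarrow> complex" where
  "P_prod n = (\<Prod>k=1..n. poly P (q ^ k))"

lemma P_prod_nz [simp]: "P_prod n \<noteq> 0"
  using P_nz by (auto simp: P_prod_def)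

lemma P_prod_Suc: "P_prod (Suc n) = poly P (q ^ Suc n) * P_prod n"
  by (simp add: P_prod_def)

lemma norm_poly_P_le: "norm (poly P (q ^ k)) \<le> pnorm P * norm q ^ (d * k)"
proof -
  \<comment> \<open>The degree is relaxed to an upper bound \<open>D\<close> so that the induction
    over the coefficients closes.\<close>
  have "norm (poly p (q ^ k)) \<le> pnorm p * norm q ^ (D * k)" if "degree p \<le> D" for p D
    using that
  proof (induction p arbitrary: D)
    case (pCons a p)
    have 1: "1 \<le> norm q ^ (D * k)" using norm_q by simp
    have "norm (q ^ k * poly p (q ^ k)) \<le> pnorm p * norm q ^ (D * k)"
    proof (cases "p = 0")
      case False
      then obtain D' where D': "D = Suc D'" "degree p \<le> D'"
        using pCons.prems by (cases D) auto
      have "norm q ^ k * norm (poly p (q ^ k)) \<le> norm q ^ k * (pnorm p * norm q ^ (D' * k))"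
        by (intro mult_left_mono pCons.IH D') auto
      then show ?thesis by (simp add: norm_mult norm_power D' power_add mult_ac)
    qed simp
    moreover have "norm a \<le> norm a * norm q ^ (D * k)"
      using mult_left_mono[OF 1, of "norm a"] by simp
    ultimately show ?case
      using norm_triangle_ineq[of a "q ^ k * poly p (q ^ k)"] by (simp add: distrib_right)
  qed simp
  then show ?thesis by (simp add: d_def)
qed

lemma norm_P_prod_le:
  assumes "pnorm P \<le> C" "1 \<le> C"
  shows "norm (P_prod n) \<le> C ^ n * exp (ln (norm q) * (real d * (real n * (real n + 1) / 2)))"
proof (induction n)
  case (Suc n)
  have "norm (P_prod (Suc n)) \<le> (C * norm q ^ (d * Suc n)) *
      (C ^ n * exp (ln (norm q) * (real d * (real n * (real n + 1) / 2))))"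
    unfolding P_prod_Suc norm_mult
    by (intro mult_mono Suc.IH order_trans[OF norm_poly_P_le] mult_right_mono assms)
       (use assms in auto)
  also have "\<dots> = C ^ Suc n * exp (ln (norm q) * (real d * (real (Suc n) * (real (Suc n) + 1) / 2)))"
    unfolding norm_q_power by (simp add: mult_ac exp_add[symmetric]) (simp add: field_simps)
  finally show ?case .
qed (simp add: P_prod_def)

text \<open>A root at a negative level has modulus at most that of its \<open>\<alpha> j\<close>, so
  each of the \<open>S * R\<close> linear factors has norm at most \<open>W\<close>. The cost is
  only exponential in \<open>R\<close>, without a quadratic exponent.\<close>

lemma pnorm_T_le:
  assumes "\<And>j. j \<in> {1..m} \<Longrightarrow> 1 + norm (\<alpha> j) \<le> W" "1 \<le> W"
  shows "pnorm (T R) \<le> W ^ (S * R)"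
proof (induction R)
  case (Suc R)
  have "norm (\<alpha> j / q ^ Suc R) \<le> norm (\<alpha> j)" for j
  proof -
    have "1 \<le> norm q ^ Suc R" using norm_q by (intro one_le_power) auto
    then show ?thesis
      by (simp add: norm_divide norm_mult norm_power divide_le_eq mult_le_cancel_left1 norm_q
          del: power_Suc)
  qed
  then have "1 + norm (\<alpha> j * (1 / q ^ Suc R)) \<le> W" if "j \<in> {1..m}" for j
    using assms(1)[OF that] by (smt (verit) mult.right_neutral times_divide_eq_right)
  then have "pnorm (block (1 / q ^ Suc R)) \<le> W ^ S"
    unfolding block_def by (intro pnorm_block_le) auto
  then have "pnorm (T (Suc R)) \<le> W ^ S * W ^ (S * R)"
    unfolding T_Suc using assms(2)
    by (intro order_trans[OF pnorm_mult] mult_mono Suc.IH) auto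
  then show ?case by (simp add: power_add)
qed (simp add: levels_def)

text \<open>This bounds the factor that multiplies the linear form. \<open>T R\<close> reaches up to
  the index \<open>N + S * R\<close>, where \<open>P_prod\<close> has the quadratic exponent shown;
  all exponents that are linear in \<open>R\<close> and \<open>N\<close> go into
  \<open>K\<close>.\<close>

lemma shift_op_T_P_prod_bound:
  "\<exists>K\<ge>0. \<forall>R N. norm (shift_op (T R) P_prod N) \<le>
     exp (K * (real R + real N + 1) + ln (norm q) * (real d * (real N + real (S * R))\<^sup>2 / 2))"
proof -
  define W where "W = 1 + (\<Sum>j=1..m. norm (\<alpha> j))"
  define C where "C = 1 + pnorm P"
  define Q where "Q = ln (norm q)"
  have Q: "Q > 0" using norm_q by (simp add: Q_def)
  have W: "1 + norm (\<alpha> j) \<le> W" if "j \<in> {1..m}" for j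
    unfolding W_def using that by (auto intro!: member_le_sum)
  have W1: "1 \<le> W" by (simp add: W_def sum_nonneg)
  have C1: "1 \<le> C" by (simp add: C_def)
  define K0 where "K0 = ln W + ln C + Q * d"
  have K0: "ln W \<ge> 0" "ln C \<ge> 0" "Q * d \<ge> 0" using W1 C1 Q by auto
  show ?thesis
  proof (intro exI[of _ "K0 * real (S + 1)"] conjI allI)
    show "0 \<le> K0 * real (S + 1)" using K0 by (simp add: K0_def)
    fix R N :: nat
    define n where "n = N + S * R"
    have "norm (P_prod (N + i)) \<le> C ^ n * exp (Q * (real d * (real n * (real n + 1) / 2)))"
      if "i \<le> degree (T R)" for i
    proof -
      have i: "N + i \<le> n" using that by (simp add: n_def mult.commute)
      have "real (N + i) * (real (N + i) + 1) \<le> real n * (real n + 1)"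
        using i by (intro mult_mono) auto
      then have "exp (Q * (real d * (real (N + i) * (real (N + i) + 1) / 2)))
          \<le> exp (Q * (real d * (real n * (real n + 1) / 2)))"
        using Q by (simp add: mult_left_mono)
      moreover have "C ^ (N + i) \<le> C ^ n" using i C1 by (rule power_increasing)
      ultimately have "C ^ (N + i) * exp (Q * (real d * (real (N + i) * (real (N + i) + 1) / 2)))
          \<le> C ^ n * exp (Q * (real d * (real n * (real n + 1) / 2)))"
        using C1 by (intro mult_mono) auto
      moreover have "norm (P_prod (N + i)) \<le> C ^ (N + i) * exp (Q * (real d * (real (N + i) * (real (N + i) + 1) / 2)))"
        unfolding Q_def by (rule norm_P_prod_le) (auto simp: C_def)
      ultimately show ?thesis by linarith
    qed
    then have "norm (shift_op (T R) P_prod N) \<le>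
        pnorm (T R) * (C ^ n * exp (Q * (real d * (real n * (real n + 1) / 2))))"
      by (rule norm_shift_op_le)
    also have "\<dots> \<le> W ^ n * (C ^ n * exp (Q * (real d * (real n * (real n + 1) / 2))))"
      using W1 C1 pnorm_T_le[OF W W1, of R] power_increasing[of "S * R" n W]
      by (intro mult_right_mono) (auto simp: n_def)
    also have "\<dots> = exp ((ln W + ln C + Q * real d / 2) * n + Q * (real d * (real n)\<^sup>2 / 2))"
    proof -
      have "W ^ n = exp (ln W * n)" "C ^ n = exp (ln C * n)"
        using W1 C1 by (simp_all add: exp_of_nat2_mult)
      then show ?thesis
        by (simp add: exp_add[symmetric] power2_eq_square) (simp add: field_simps)
    qed
    also have "\<dots> \<le> exp (K0 * real (S + 1) * (real R + real N + 1) + Q * (real d * (real n)\<^sup>2 / 2))"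
    proof -
      have "n \<le> (S + 1) * (R + N + 1)" by (simp add: n_def algebra_simps)
      then have "real n \<le> real (S + 1) * (real R + real N + 1)"
        using of_nat_mono[of _ "(S + 1) * (R + N + 1)", where 'a = real] by (force simp: algebra_simps)
      then have "(ln W + ln C + Q * real d / 2) * n \<le> K0 * (real (S + 1) * (real R + real N + 1))"
        using K0 by (intro mult_mono) (auto simp: K0_def)
      then show ?thesis by (simp add: mult.assoc)
    qed
    finally show "norm (shift_op (T R) P_prod N) \<le>
        exp (K0 * real (S + 1) * (real R + real N + 1) + ln (norm q) * (real d * (real N + real (S * R))\<^sup>2 / 2))"
      by (simp add: Q_def n_def)
  qed
qed

end

section \<open>Integrality and common denominators\<close>

definition int_poly :: "complex poly \<Rightarrow> bool" where
  "int_poly p \<longleftrightarrow> (\<forall>i. coeff p i \<in> \<int>)"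

lemma int_poly_mult: "int_poly p \<Longrightarrow> int_poly r \<Longrightarrow> int_poly (p * r)"
  by (auto simp: int_poly_def coeff_mult intro!: Ints_sum Ints_mult)

lemma int_poly_1: "int_poly 1"
  by (auto simp: int_poly_def coeff_1)

lemma int_poly_power: "int_poly p \<Longrightarrow> int_poly (p ^ n)"
  by (induction n) (auto intro: int_poly_mult int_poly_1)

lemma int_poly_prod: "(\<And>x. x \<in> X \<Longrightarrow> int_poly (p x)) \<Longrightarrow> int_poly (\<Prod>x\<in>X. p x)"
  by (induction X rule: infinite_finite_induct) (auto intro: int_poly_mult int_poly_1)

lemma shift_op_int:
  assumes "int_poly p" "\<And>i. i \<le> degree p \<Longrightarrow> c * v (n + i) \<in> \<int>"
  shows "c * shift_op p v n \<in> \<int>"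
proof -
  have "c * shift_op p v n = (\<Sum>i\<le>degree p. coeff p i * (c * v (n + i)))"
    by (simp add: shift_op_def sum_distrib_left mult_ac)
  also have "\<dots> \<in> \<int>"
    using assms by (intro Ints_sum Ints_mult[of "coeff p _"]) (auto simp: int_poly_def)
  finally show ?thesis .
qed

lemma norm_Ints_ge_1: "x \<in> \<int> \<Longrightarrow> x \<noteq> 0 \<Longrightarrow> 1 \<le> norm (x :: complex)"
  by (elim Ints_cases) (simp flip: of_int_abs)

locale q_rational = q_system +
  fixes q1 q2 b :: int
  assumes q_eq: "q = of_int q1 / of_int q2" and q2_nz: "q2 \<noteq> 0"
    and b_pos: "b > 0"
    and b_\<alpha>: "j \<in> {1..m} \<Longrightarrow> of_int b * \<alpha> j \<in> \<int>"
    and b_P: "of_int b * coeff P i \<in> \<int>"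
begin

lemma q1_nz: "q1 \<noteq> 0"
  using q_nz q_eq by auto

text \<open>In the step to \<open>Suc n\<close>, the factor \<open>b * q2 ^ (d * (n + 1))\<close>
  clears \<open>P (q ^ (n + 1))\<close>. The remaining \<open>b * q2 ^ d\<close> makes
  \<open>den n\<close> a multiple of the denominator of \<open>u A n\<close>.\<close>

primrec den :: "nat \<Rightarrow> int" where
  "den 0 = 1"
| "den (Suc n) = den n * (b ^ 2 * q2 ^ (d * (n + 2)))"

lemma q_power_int: "k \<le> l \<Longrightarrow> of_int q2 ^ l * q ^ k \<in> \<int>"
proof -
  assume "k \<le> l"
  then obtain e where "l = k + e" by (metis le_add_diff_inverse)
  then have "of_int q2 ^ l * q ^ k = of_int (q2 ^ e * q1 ^ k)"
    using q2_nz by (simp add: q_eq power_add power_divide)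
  then show ?thesis by (metis Ints_of_int)
qed

lemma u_int:
  assumes "\<And>i. i \<in> idx \<Longrightarrow> A i \<in> \<int>"
  shows "of_int ((b * q2 ^ d) ^ n) * u A n \<in> \<int>"
proof -
  have "of_int ((b * q2 ^ d) ^ n) * binom_exp (\<alpha> j * q ^ k) \<sigma> n \<in> \<int>"
    if "j \<in> {1..m}" "k < d" for j k \<sigma>
  proof (cases "\<sigma> \<le> n")
    case True
    then have "of_int ((b * q2 ^ d) ^ n) * binom_exp (\<alpha> j * q ^ k) \<sigma> n =
        of_nat (n choose \<sigma>) * of_int ((b * q2 ^ d) ^ \<sigma>) *
        ((of_int b * \<alpha> j) * (of_int q2 ^ d * q ^ k)) ^ (n - \<sigma>)"
      by (simp add: binom_exp_def mult_ac flip: power_mult_distrib)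
         (simp add: power_mult_distrib mult_ac flip: power_add)
    also have "\<dots> \<in> \<int>"
      using that by (intro Ints_mult Ints_power b_\<alpha> q_power_int) auto
    finally show ?thesis .
  qed (simp add: binom_exp_def binomial_eq_0)
  then have "A (j, k, \<sigma>) * fact \<sigma> * (of_int ((b * q2 ^ d) ^ n) * binom_exp (\<alpha> j * q ^ k) \<sigma> n) \<in> \<int>"
    if "(j, k, \<sigma>) \<in> idx" for j k \<sigma>
    using that assms[OF that] by (intro Ints_mult[of "A _ * _"] Ints_mult[of "A _"]) (auto simp: fact_in_Ints)
  then show ?thesis
    unfolding u_def sum_distrib_left by (intro Ints_sum) (auto simp: mult_ac)
qed

lemma den_dvd: "(b * q2 ^ d) ^ n dvd den n"
proof (induction n)
  case (Suc n)
  have "b * q2 ^ d dvd b ^ 2 * q2 ^ (d * (n + 2))"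
    by (intro mult_dvd_mono le_imp_power_dvd) auto
  with Suc show ?case by (simp only: den.simps power_Suc2 mult_dvd_mono)
qed simp

lemma den_mono: "n \<le> n' \<Longrightarrow> den n dvd den n'"
  by (induction n' rule: dec_induct) (auto intro: dvd_trans)

lemma Ints_dvd_mult:
  assumes "of_int a * x \<in> \<int>" "a dvd c"
  shows "of_int c * x \<in> (\<int> :: complex set)"
proof -
  obtain e where "c = a * e" using assms(2) by (elim dvdE)
  then have "of_int c * x = of_int e * (of_int a * x)" by simp
  then show ?thesis using assms(1) by (metis Ints_mult Ints_of_int)
qed

lemma v_int:
  assumes "A0 \<in> \<int>" "\<And>i. i \<in> idx \<Longrightarrow> A i \<in> \<int>"
  shows "of_int (den n) * v A0 A n \<in> \<int>"
proof (induction n)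
  case 0
  then show ?case using assms u_int[of A 0] by auto
next
  case (Suc n)
  have "of_int (b * q2 ^ (d * Suc n)) * poly P (q ^ Suc n) =
      (\<Sum>i\<le>d. (of_int b * coeff P i) * (of_int q2 ^ (d * Suc n) * q ^ (i * Suc n)))"
    unfolding poly_P_altdef sum_distrib_left by (simp add: mult_ac flip: power_mult del: power_Suc)
  also have "\<dots> \<in> \<int>"
    by (intro Ints_sum Ints_mult b_P q_power_int) (auto simp del: mult_Suc_right)
  finally have P: "of_int (b * q2 ^ (d * Suc n)) * poly P (q ^ Suc n) \<in> \<int>" .
  have "of_int (den (Suc n)) * v A0 A (Suc n) =
      (of_int (b * q2 ^ (d * Suc n)) * poly P (q ^ Suc n)) * (of_int (den n) * v A0 A n) * of_int (b * q2 ^ d)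
      + of_int (den (Suc n)) * u A (Suc n)"
    by (simp add: algebra_simps power2_eq_square power_add)
  also have "\<dots> \<in> \<int>"
    by (intro Ints_add Ints_mult P Suc.IH Ints_of_int Ints_dvd_mult[OF u_int[OF assms(2)] den_dvd])
  finally show ?case .
qed

text \<open>A root at level \<open>- r\<close> is \<open>\<alpha> j * q2 ^ r / q1 ^ r\<close>; its
  linear factor is cleared by \<open>b * q1 ^ r\<close>, and there are \<open>S\<close> such factors
  per level.\<close>

definition T_den :: "nat \<Rightarrow> int" where
  "T_den R = (\<Prod>r=1..R. (b * q1 ^ r) ^ S)"

lemma T_int: "int_poly (smult (of_int (T_den R)) (T R))"
proof (induction R)
  case (Suc R)
  define c :: complex where "c = of_int (b * q1 ^ Suc R)"
  have "smult (c ^ S) (block (1 / q ^ Suc R)) = (\<Prod>j=1..m. smult (c ^ s j) ([:- (\<alpha> j * (1 / q ^ Suc R)), 1:] ^ s j))"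
    by (simp add: block_def prod_smult S_def power_sum)
  also have "\<dots> = (\<Prod>j=1..m. [:- (of_int b * \<alpha> j * of_int q2 ^ Suc R), c:] ^ s j)"
  proof -
    have "c / q ^ Suc R = of_int b * of_int q2 ^ Suc R"
      using q1_nz q2_nz by (simp add: c_def q_eq field_simps)
    then have "c * (\<alpha> j * (1 / q ^ Suc R)) = of_int b * \<alpha> j * of_int q2 ^ Suc R" for j
      by (simp add: field_simps)
    then show ?thesis by (simp add: smult_power[symmetric] del: power_Suc)
  qed
  also have "int_poly \<dots>"
    by (intro int_poly_prod int_poly_power)
       (auto simp: int_poly_def c_def coeff_pCons split: nat.splits intro!: Ints_mult Ints_power b_\<alpha>)
  finally have "int_poly (smult (c ^ S) (block (1 / q ^ Suc R)))" .
  from int_poly_mult[OF this Suc] show ?case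
    unfolding T_Suc by (simp add: T_den_def c_def mult_ac power_mult_distrib del: power_Suc of_nat_Suc)
qed (simp add: levels_def T_den_def int_poly_1[unfolded one_pCons])

lemma T_den_nz: "T_den R \<noteq> 0"
  using b_pos q1_nz by (auto simp: T_den_def)

lemma den_nz: "den n \<noteq> 0"
  using b_pos q2_nz by (induction n) auto

lemma norm_T_den: "real_of_int \<bar>T_den R\<bar> =
    exp (ln b * (real S * real R) + ln \<bar>q1\<bar> * (real S * (real R * (real R + 1) / 2)))"
proof (induction R)
  case (Suc R)
  have "real_of_int \<bar>T_den (Suc R)\<bar> = \<bar>T_den R\<bar> * (real_of_int b * real_of_int \<bar>q1\<bar> ^ Suc R) ^ S"
    using b_pos by (simp add: T_den_def abs_mult power_abs del: power_Suc)
  also have "(real_of_int b * real_of_int \<bar>q1\<bar> ^ Suc R) ^ S = exp ((ln b + real (Suc R) * ln \<bar>q1\<bar>) * real S)"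
  proof -
    have "real_of_int b * real_of_int \<bar>q1\<bar> ^ Suc R = exp (ln b + real (Suc R) * ln \<bar>q1\<bar>)"
      using b_pos q1_nz by (simp only: exp_add exp_of_nat_mult) simp
    then show ?thesis by (simp only: exp_of_nat2_mult)
  qed
  finally show ?case
    unfolding Suc by (simp only: exp_add[symmetric]) (simp add: field_simps)
qed (simp add: T_den_def)

lemma norm_den: "real_of_int \<bar>den n\<bar> =
    exp (ln b * (2 * real n) + ln \<bar>q2\<bar> * (real d * (real n * (real n + 3) / 2)))"
proof (induction n)
  case (Suc n)
  have "real_of_int \<bar>den (Suc n)\<bar> = \<bar>den n\<bar> * ((real_of_int b)\<^sup>2 * real_of_int \<bar>q2\<bar> ^ (d * (n + 2)))"
    using b_pos by (simp add: abs_mult power_abs)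
  also have "(real_of_int b)\<^sup>2 * real_of_int \<bar>q2\<bar> ^ (d * (n + 2)) = exp (ln b * 2 + real (d * (n + 2)) * ln \<bar>q2\<bar>)"
    using b_pos q2_nz by (simp only: exp_add exp_of_nat_mult) (simp add: power2_eq_square exp_add[symmetric] exp_double mult.commute)
  finally show ?case
    unfolding Suc by (simp only: exp_add[symmetric]) (simp add: field_simps)
qed simp

text \<open>Multiplied by \<open>den (N + S * R)\<close> and \<open>T_den R\<close>, the value
  becomes a nonzero integer, so its modulus is at least 1. The quadratic exponents are those of the
  two denominators; \<open>K\<close> collects their linear parts.\<close>

lemma shift_op_T_v_lower:
  "\<exists>K\<ge>0. \<forall>R N A0 A. A0 \<in> \<int> \<longrightarrow> (\<forall>i\<in>idx. A i \<in> \<int>) \<longrightarrow> shift_op (T R) (v A0 A) N \<noteq> 0 \<longrightarrow>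
     1 \<le> exp (K * (real R + real N + 1) + ln \<bar>q1\<bar> * (real S * (real R)\<^sup>2 / 2)
          + ln \<bar>q2\<bar> * (real d * (real N + real (S * R))\<^sup>2 / 2))
        * norm (shift_op (T R) (v A0 A) N)"
proof -
  define K where "K = 3 * ln b * (S + 1) + ln \<bar>q1\<bar> * S + 3 * ln \<bar>q2\<bar> * d * (S + 1)"
  have pos: "ln b \<ge> 0" "ln \<bar>q1\<bar> \<ge> 0" "ln \<bar>q2\<bar> \<ge> 0"
    using b_pos q1_nz q2_nz by auto
  show ?thesis
  proof (intro exI[of _ K] conjI allI impI)
    show "K \<ge> 0" using pos by (simp add: K_def)
    fix R N :: nat and A0 A
    assume A0: "A0 \<in> \<int>" and A: "\<forall>i\<in>idx. A i \<in> \<int>"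
      and nz: "shift_op (T R) (v A0 A) N \<noteq> 0"
    define n where "n = N + S * R"
    define w where "w = shift_op (T R) (v A0 A) N"
    have "of_int (den n) * shift_op (smult (of_int (T_den R)) (T R)) (v A0 A) N \<in> \<int>"
    proof (rule shift_op_int[OF T_int])
      fix i assume "i \<le> degree (smult (complex_of_int (T_den R)) (T R))"
      then have "N + i \<le> n" by (simp add: n_def T_den_nz mult.commute)
      then show "of_int (den n) * v A0 A (N + i) \<in> \<int>"
        using A by (intro Ints_dvd_mult[OF v_int[OF A0] den_mono]) auto
    qed
    then have "of_int (den n) * (of_int (T_den R) * w) \<in> \<int>"
      by (simp add: shift_op_smult w_def)
    moreover have "of_int (den n) * (of_int (T_den R) * w) \<noteq> 0"
      using nz by (simp add: w_def T_den_nz den_nz)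
    ultimately have "1 \<le> norm (of_int (den n) * (of_int (T_den R) * w))"
      by (rule norm_Ints_ge_1)
    also have "\<dots> = real_of_int \<bar>den n\<bar> * real_of_int \<bar>T_den R\<bar> * norm w"
      by (simp add: norm_mult)
    also have "real_of_int \<bar>den n\<bar> * real_of_int \<bar>T_den R\<bar> \<le>
        exp (K * (real R + real N + 1) + ln \<bar>q1\<bar> * (real S * (real R)\<^sup>2 / 2)
          + ln \<bar>q2\<bar> * (real d * (real n)\<^sup>2 / 2))"
    proof -
      have "n \<le> (S + 1) * (R + N + 1)" by (simp add: n_def algebra_simps)
      then have n: "real n \<le> real (S + 1) * (real R + real N + 1)"
        using of_nat_mono[of _ "(S + 1) * (R + N + 1)", where 'a = real] by (force simp: algebra_simps)
      have "S * R \<le> (S + 1) * (R + N + 1)" by (simp add: algebra_simps)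
      then have "real (S * R) \<le> real (S + 1) * (real R + real N + 1)"
        using of_nat_mono[of _ "(S + 1) * (R + N + 1)", where 'a = real] by (force simp: algebra_simps)
      then have "2 * real n + real S * real R \<le> 3 * (real (S + 1) * (real R + real N + 1))"
        using n by simp
      from mult_left_mono[OF this pos(1)]
      have 1: "ln b * (2 * real n) + ln b * (real S * real R) \<le> 3 * ln b * real (S + 1) * (real R + real N + 1)"
        by (simp add: distrib_left mult_ac)
      have "real S * real R / 2 \<le> real S * (real R + real N + 1)"
        by (simp add: distrib_left)
      from mult_left_mono[OF this pos(2)]
      have 2: "ln \<bar>q1\<bar> * (real S * real R / 2) \<le> ln \<bar>q1\<bar> * S * (real R + real N + 1)"
        by (simp add: mult_ac)
      have "real d * (3 * real n / 2) \<le> real d * (3 * (real (S + 1) * (real R + real N + 1)))"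
        using n by (intro mult_left_mono) auto
      from mult_left_mono[OF this pos(3)]
      have 3: "ln \<bar>q2\<bar> * (real d * (3 * real n / 2)) \<le> 3 * ln \<bar>q2\<bar> * d * real (S + 1) * (real R + real N + 1)"
        by (simp add: mult_ac)
      have 4: "ln \<bar>q2\<bar> * (real d * (real n * (real n + 3) / 2)) =
          ln \<bar>q2\<bar> * (real d * (3 * real n / 2)) + ln \<bar>q2\<bar> * (real d * (real n)\<^sup>2 / 2)"
        by (simp add: field_simps power2_eq_square)
      have 5: "ln \<bar>q1\<bar> * (real S * (real R * (real R + 1) / 2)) =
          ln \<bar>q1\<bar> * (real S * real R / 2) + ln \<bar>q1\<bar> * (real S * (real R)\<^sup>2 / 2)"
        by (simp add: field_simps power2_eq_square)
      have "K * (real R + real N + 1) = 3 * ln b * real (S + 1) * (real R + real N + 1) +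
          ln \<bar>q1\<bar> * S * (real R + real N + 1) + 3 * ln \<bar>q2\<bar> * d * real (S + 1) * (real R + real N + 1)"
        by (simp only: K_def distrib_right)
      then show ?thesis
        unfolding norm_den norm_T_den exp_add[symmetric] exp_le_cancel_iff 4 5
        using 1 2 3 by linarith
    qed
    finally show "1 \<le> exp (K * (real R + real N + 1) + ln \<bar>q1\<bar> * (real S * (real R)\<^sup>2 / 2)
          + ln \<bar>q2\<bar> * (real d * (real N + real (S * R))\<^sup>2 / 2)) * norm (shift_op (T R) (v A0 A) N)"
      by (simp add: n_def w_def mult_right_mono)
  qed
qed

end

section \<open>The tail\<close>

context q_system
begin

text \<open>This is the weight of \<open>u (n + l)\<close> in the tail of the linear form after
  multiplication by \<open>P_prod n\<close>. It equals \<open>P_prod n / P_prod (n + l)\<close>; the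
  product form is the one that is expanded in powers of \<open>1 / q ^ n\<close>.\<close>

definition G :: "nat \<Rightarrow> nat \<Rightarrow> complex" where
  "G l n = 1 / (\<Prod>i=1..l. poly P (q ^ (n + i)))"

text \<open>The sequence is an exponential at the negative level \<open>k - r\<close>, which
  \<open>T R\<close> kills if \<open>r < R\<close>. For \<open>r \<ge> R\<close>, a factor of
  \<open>T R\<close> at level \<open>- i\<close> contributes at most \<open>W / norm q ^ i\<close>,
  because \<open>1 / q ^ r\<close> is no larger than \<open>1 / q ^ i\<close>. Multiplying over all
  levels gives the quadratic saving.\<close>

lemma norm_shift_op_T_binom_exp_le:
  assumes W: "\<And>i j k. i \<in> {1..m} \<Longrightarrow> j \<in> {1..m} \<Longrightarrow> k < d \<Longrightarrow> 1 + norm (\<alpha> j * q ^ k) + norm (\<alpha> i) \<le> W"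
    and j: "j \<in> {1..m}" "k < d" "\<sigma> < s j" and "k < r"
  shows "norm (shift_op (T R) (\<lambda>n. (1 / q ^ r) ^ n * binom_exp (\<alpha> j * q ^ k) \<sigma> (n + l)) N) \<le>
    (if R \<le> r then (1 / norm q ^ r) ^ N * W ^ (N + l + S * R)
        * exp (- ln (norm q) * (real S * (real R * (real R + 1) / 2))) else 0)"
proof -
  define t where "t = 1 / q ^ r"
  define \<beta> where "\<beta> = \<alpha> j * q ^ k"
  have t: "t = q powi (- int r)" by (simp add: t_def power_int_minus field_simps)
  have "W \<ge> 1" using W[OF j(1,1,2)] by (smt (verit) norm_ge_zero)
  have eq: "shift_op (T R) (\<lambda>n. t ^ n * binom_exp \<beta> \<sigma> (n + l)) N =
      t ^ N * shift_op (pcompose (T R) [:0, t:]) (binom_exp \<beta> \<sigma>) (N + l)"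
    by (simp only: shift_op_scale shift_op_shift)
  show ?thesis
  proof (cases "R \<le> r")
    case False
    \<comment> \<open>Scaled by \<open>t\<close>, the levels of \<open>T R\<close> run from
      \<open>r - R\<close> to \<open>r - 1\<close>. Since \<open>k < r < R\<close>, this range
      contains \<open>k\<close>.\<close>
    have "[:- (\<alpha> j * q powi int k), 1:] ^ s j dvd levels (- int R - - int r) (0 - - int r)"
      by (rule root_power_dvd_levels) (use j False \<open>k < r\<close> in auto)
    then have "[:- \<beta>, 1:] ^ s j dvd pcompose (T R) [:0, t:]"
      unfolding t pcompose_levels \<beta>_def power_int_of_nat by (rule dvd_smult)
    then have "shift_op (pcompose (T R) [:0, t:]) (binom_exp \<beta> \<sigma>) (N + l) = 0"
      by (rule shift_op_root_power_less) fact
    then show ?thesis using False eq by (simp add: t_def \<beta>_def)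
  next
    case True
    have *: "pnorm (pcompose (pcompose (T R') [:0, t:]) [:\<beta>, 1:]) \<le>
        W ^ (S * R') * exp (- ln (norm q) * (real S * (real R' * (real R' + 1) / 2)))"
      if "R' \<le> R" for R'
      using that
    proof (induction R')
      case (Suc R')
      define c where "c = 1 / q ^ Suc R'"
      have tc: "norm t \<le> norm c"
      proof -
        have "norm q ^ Suc R' \<le> norm q ^ r"
          using norm_q True Suc.prems by (intro power_increasing) auto
        then show ?thesis using norm_q by (simp add: t_def c_def norm_divide norm_mult norm_power frac_le)
      qed
      \<comment> \<open>Scaling by \<open>t\<close> and recentring at \<open>\<beta>\<close> sends
        \<open>x - \<alpha> j * c\<close> to \<open>t * x + t * \<beta> - \<alpha> j * c\<close>,
        whose coefficients are at most of the order of \<open>c\<close>.\<close>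
      have "pcompose (pcompose (block c) [:0, t:]) [:\<beta>, 1:] = (\<Prod>j=1..m. [:- (\<alpha> j * c - t * \<beta>), t:] ^ s j)"
        unfolding block_def pcompose_prod
        by (intro prod.cong refl) (simp add: pcompose_power pcompose_pCons)
      also have "pnorm \<dots> \<le> (\<Prod>j=1..m. pnorm ([:- (\<alpha> j * c - t * \<beta>), t:] ^ s j))"
        by (rule pnorm_prod)
      also have "\<dots> \<le> (\<Prod>i=1..m. (norm c * W) ^ s i)"
      proof (intro prod_mono conjI pnorm_nonneg order_trans[OF pnorm_power] power_mono)
        fix i assume i: "i \<in> {1..m}"
        have "pnorm [:- (\<alpha> i * c - t * \<beta>), t:] \<le> norm c * norm (\<alpha> i) + norm t * norm \<beta> + norm t"
          using norm_triangle_ineq4[of "\<alpha> i * c" "t * \<beta>"]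
          by (simp add: norm_mult norm_minus_commute mult.commute)
        also have "\<dots> \<le> norm c * norm (\<alpha> i) + norm c * norm \<beta> + norm c"
          by (intro add_mono mult_right_mono tc) auto
        finally have 1: "pnorm [:- (\<alpha> i * c - t * \<beta>), t:] \<le> norm c * (1 + norm \<beta> + norm (\<alpha> i))"
          by (simp add: algebra_simps)
        have "norm c * (1 + norm \<beta> + norm (\<alpha> i)) \<le> norm c * W"
          using W[OF i j(1,2)] by (intro mult_left_mono) (auto simp: \<beta>_def)
        with 1 show "pnorm [:- (\<alpha> i * c - t * \<beta>), t:] \<le> norm c * W" by linarith
      qed
      also have "\<dots> = norm c ^ S * W ^ S"
        by (simp add: S_def power_sum prod.distrib power_mult_distrib)
      finally have "pnorm (pcompose (pcompose (block c) [:0, t:]) [:\<beta>, 1:]) \<le> norm c ^ S * W ^ S" .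
      then have "pnorm (pcompose (pcompose (T (Suc R')) [:0, t:]) [:\<beta>, 1:]) \<le> (norm c ^ S * W ^ S) *
          (W ^ (S * R') * exp (- ln (norm q) * (real S * (real R' * (real R' + 1) / 2))))"
        unfolding T_Suc c_def[symmetric] pcompose_mult
        using \<open>W \<ge> 1\<close> Suc.prems
        by (intro order_trans[OF pnorm_mult] mult_mono Suc.IH) auto
      also have "norm c ^ S = exp (- ln (norm q) * (real (Suc R') * real S))"
      proof -
        have "norm c = exp (- ln (norm q) * real (Suc R'))"
          by (simp add: c_def norm_divide norm_power norm_q_power exp_minus inverse_eq_divide
              del: power_Suc of_nat_Suc)
        then show ?thesis by (simp only: exp_of_nat2_mult[symmetric]) (simp add: mult_ac)
      qed
      also have "exp (- ln (norm q) * (real (Suc R') * real S)) * W ^ S *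
          (W ^ (S * R') * exp (- ln (norm q) * (real S * (real R' * (real R' + 1) / 2)))) =
          W ^ (S * Suc R') * exp (- ln (norm q) * (real S * (real (Suc R') * (real (Suc R') + 1) / 2)))"
      proof -
        have *: "- ln (norm q) * (real S * (real (Suc R') * (real (Suc R') + 1) / 2)) =
            - ln (norm q) * (real (Suc R') * real S) + - ln (norm q) * (real S * (real R' * (real R' + 1) / 2))"
          by (simp add: algebra_simps add_divide_distrib)
        show ?thesis unfolding * exp_add by (simp add: power_add)
      qed
      finally show ?case .
    qed (simp add: levels_def pcompose_1)
    have "norm (shift_op (pcompose (T R) [:0, t:]) (binom_exp \<beta> \<sigma>) (N + l)) \<le>
        pnorm ([:\<beta>, 1:] ^ (N + l)) * pnorm (pcompose (pcompose (T R) [:0, t:]) [:\<beta>, 1:])"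
      unfolding shift_op_binom_exp by (rule order_trans[OF norm_coeff_le_pnorm pnorm_mult])
    also have "\<dots> \<le> W ^ (N + l) * (W ^ (S * R) * exp (- ln (norm q) * (real S * (real R * (real R + 1) / 2))))"
    proof (intro mult_mono *)
      have "pnorm [:\<beta>, 1:] \<le> W"
        using W[OF j(1,1,2)] norm_ge_zero[of "\<alpha> j"] unfolding \<beta>_def pnorm_pCons pnorm_0 norm_one by linarith
      then show "pnorm ([:\<beta>, 1:] ^ (N + l)) \<le> W ^ (N + l)"
        by (intro order_trans[OF pnorm_power] power_mono) auto
    qed (use \<open>W \<ge> 1\<close> in auto)
    finally have "norm (t ^ N) * norm (shift_op (pcompose (T R) [:0, t:]) (binom_exp \<beta> \<sigma>) (N + l)) \<le>
        norm (t ^ N) * (W ^ (N + l) * (W ^ (S * R) * exp (- ln (norm q) * (real S * (real R * (real R + 1) / 2)))))"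
      by (rule mult_left_mono) simp
    then show ?thesis
      using True eq by (simp add: t_def \<beta>_def norm_mult norm_power norm_divide power_add mult_ac)
  qed
qed

text \<open>Expand \<open>G l n\<close> in powers of \<open>1 / q ^ n\<close>. The terms of exponent
  below \<open>R\<close> are killed, so the sum starts with a power that gives the decay in
  \<open>N * R\<close>. The weight \<open>\<epsilon>\<close> adds the decay of the coefficients at
  exponent \<open>R\<close>, and \<open>(1 / 2) ^ l\<close> is kept for the summation over
  \<open>l\<close>.\<close>

lemma norm_shift_op_T_tail_le:
  fixes c :: "nat \<Rightarrow> nat \<Rightarrow> complex" and K \<epsilon> :: real
  assumes sums: "\<And>l n. N1 \<le> n \<Longrightarrow> (\<lambda>i. c l i * (1 / q ^ n) ^ (d * l + i)) sums G l n"
    and c: "\<And>l i. norm (c l i) \<le> K ^ (d * l + i) *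
              exp (- ln (norm q) * (\<epsilon> * (real (d * l + i))\<^sup>2 / (2 * real d)))"
    and "K \<ge> 1" "\<epsilon> \<ge> 0"
    and W: "\<And>i j k. i \<in> {1..m} \<Longrightarrow> j \<in> {1..m} \<Longrightarrow> k < d \<Longrightarrow> 1 + norm (\<alpha> j * q ^ k) + norm (\<alpha> i) \<le> W"
    and N: "N1 \<le> N" "4 * K * W \<le> norm q ^ N"
    and j: "j \<in> {1..m}" "k < d" "\<sigma> < s j" and "l > 0"
  shows "norm (shift_op (T R) (\<lambda>n. binom_exp (\<alpha> j * q ^ k) \<sigma> (n + l) * G l n) N) \<le>
    (4 * K * W) ^ R * W ^ (N + S * R) * exp (- ln (norm q) *
        (real N * real R + real S * (real R * (real R + 1) / 2) + \<epsilon> * (real R)\<^sup>2 / (2 * real d))) * (1 / 2) ^ l"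
    (is "_ \<le> ?F * _")
proof -
  define f where "f i n = c l i * ((1 / q ^ (d * l + i)) ^ n * binom_exp (\<alpha> j * q ^ k) \<sigma> (n + l))" for i n
  define Q where "Q = ln (norm q)"
  define x where "x = K * W / norm q ^ N"
  have Q: "Q > 0" using norm_q by (simp add: Q_def)
  have W1: "W \<ge> 1" using W[OF j(1,1,2)] by (smt (verit) norm_ge_zero)
  have x: "0 \<le> x" "4 * x \<le> 1"
    using N(2) W1 \<open>K \<ge> 1\<close> norm_q by (auto simp: x_def field_simps)
  have F0: "?F \<ge> 0" using W1 \<open>K \<ge> 1\<close> by auto
  have "(\<lambda>i. f i n) sums (binom_exp (\<alpha> j * q ^ k) \<sigma> (n + l) * G l n)" if "N \<le> n" for n
  proof -
    have "N1 \<le> n" using that N by simp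
    have "(1 / q ^ n) ^ (d * l + i) = (1 / q ^ (d * l + i)) ^ n" for i
      by (simp add: power_divide mult.commute flip: power_mult)
    with sums_mult[OF sums[OF \<open>N1 \<le> n\<close>, of l], of "binom_exp (\<alpha> j * q ^ k) \<sigma> (n + l)"] show ?thesis
      by (simp add: f_def mult_ac)
  qed
  then have fs: "(\<lambda>i. shift_op (T R) (f i) N) sums shift_op (T R) (\<lambda>n. binom_exp (\<alpha> j * q ^ k) \<sigma> (n + l) * G l n) N"
    by (rule shift_op_sums)
  have bound: "norm (shift_op (T R) (f i) N) \<le> ?F * (1 / 4) ^ l * (1 / 4) ^ i" for i
  proof -
    define r where "r = d * l + i"
    have "l \<le> d * l" using d_pos by simp
    then have lr: "l + i \<le> r" by (simp add: r_def)
    have "d \<le> d * l" using \<open>l > 0\<close> by simp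
    \<comment> \<open>As \<open>l > 0\<close>, every exponent \<open>r\<close> is at least
      \<open>d\<close> and so exceeds \<open>k\<close>, which makes the level \<open>k - r\<close>
      negative.\<close>
    then have kr: "k < r" using \<open>k < d\<close> unfolding r_def by linarith
    have eq: "shift_op (T R) (f i) N =
        c l i * shift_op (T R) (\<lambda>n. (1 / q ^ r) ^ n * binom_exp (\<alpha> j * q ^ k) \<sigma> (n + l)) N"
      unfolding f_def r_def by (rule shift_op_cmult)
    note T = norm_shift_op_T_binom_exp_le[OF W j kr, of R l N]
    show ?thesis
    proof (cases "R \<le> r")
      case False
      then have "shift_op (T R) (f i) N = 0" using T eq by simp
      then show ?thesis using F0 by simp
    next
      case True
      have "norm (shift_op (T R) (f i) N) \<le> (K ^ r * exp (- Q * (\<epsilon> * (real r)\<^sup>2 / (2 * real d)))) *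
          ((1 / norm q ^ r) ^ N * W ^ (N + l + S * R) * exp (- Q * (real S * (real R * (real R + 1) / 2))))"
        unfolding eq norm_mult
        using T True c[of l i] \<open>K \<ge> 1\<close> by (intro mult_mono) (auto simp: r_def Q_def)
      also have "\<dots> \<le> (K ^ r * exp (- Q * (\<epsilon> * (real R)\<^sup>2 / (2 * real d)))) *
          ((1 / norm q ^ r) ^ N * W ^ (N + r + S * R) * exp (- Q * (real S * (real R * (real R + 1) / 2))))"
      proof -
        have "(real R)\<^sup>2 \<le> (real r)\<^sup>2" using True by (intro power_mono) auto
        then have "\<epsilon> * (real R)\<^sup>2 / (2 * real d) \<le> \<epsilon> * (real r)\<^sup>2 / (2 * real d)"
          using \<open>\<epsilon> \<ge> 0\<close> by (intro divide_right_mono mult_left_mono) auto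
        then have "Q * (\<epsilon> * (real R)\<^sup>2 / (2 * real d)) \<le> Q * (\<epsilon> * (real r)\<^sup>2 / (2 * real d))"
          using Q by (intro mult_left_mono) auto
        then have "exp (- Q * (\<epsilon> * (real r)\<^sup>2 / (2 * real d))) \<le> exp (- Q * (\<epsilon> * (real R)\<^sup>2 / (2 * real d)))"
          by simp
        moreover have "W ^ (N + l + S * R) \<le> W ^ (N + r + S * R)"
          using W1 lr by (intro power_increasing) auto
        ultimately show ?thesis
          using Q \<open>K \<ge> 1\<close> W1 by (intro mult_mono mult_left_mono mult_right_mono) auto
      qed
      also have "\<dots> = x ^ r * (W ^ (N + S * R) * exp (- Q * (\<epsilon> * (real R)\<^sup>2 / (2 * real d)))
          * exp (- Q * (real S * (real R * (real R + 1) / 2))))"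
      proof -
        have "(1 / norm q ^ r) ^ N = (1 / norm q ^ N) ^ r"
          by (simp add: power_divide mult.commute flip: power_mult)
        then show ?thesis by (simp add: x_def power_add power_mult_distrib power_divide mult_ac)
      qed
      also have "\<dots> \<le> ((4 * x) ^ R * (1 / 4) ^ (l + i)) * (W ^ (N + S * R) * exp (- Q * (\<epsilon> * (real R)\<^sup>2 / (2 * real d)))
          * exp (- Q * (real S * (real R * (real R + 1) / 2))))"
      proof (rule mult_right_mono)
        \<comment> \<open>The first \<open>R\<close> factors give the decay in \<open>N * R\<close>.
          The others are at most \<open>1 / 4\<close> each and pay for the sums over
          \<open>i\<close> and \<open>l\<close>, at the cost of a factor
          \<open>4 ^ R\<close>.\<close>
        have "x ^ r = x ^ R * x ^ (r - R)" using True by (simp flip: power_add)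
        also have "\<dots> \<le> x ^ R * (1 / 4) ^ (r - R)"
          using x by (intro mult_left_mono power_mono) auto
        also have "\<dots> = (4 * x) ^ R * (1 / 4) ^ r"
          using True by (simp add: power_diff field_simps)
        also have "\<dots> \<le> (4 * x) ^ R * (1 / 4) ^ (l + i)"
          using x lr by (intro mult_left_mono power_decreasing) auto
        finally show "x ^ r \<le> (4 * x) ^ R * (1 / 4) ^ (l + i)" .
      qed (use W1 in auto)
      also have "(4 * x) ^ R = (4 * K * W) ^ R * exp (- Q * (real N * real R))"
      proof -
        have "exp (- Q * (real N * real R)) = (1 / norm q ^ N) ^ R"
          unfolding norm_q_power Q_def
          by (simp add: exp_of_nat2_mult[symmetric] exp_minus field_simps)
        then show ?thesis by (simp add: x_def power_mult_distrib power_divide)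
      qed
      also have "(4 * K * W) ^ R * exp (- Q * (real N * real R)) * (1 / 4) ^ (l + i) *
          (W ^ (N + S * R) * exp (- Q * (\<epsilon> * (real R)\<^sup>2 / (2 * real d)))
          * exp (- Q * (real S * (real R * (real R + 1) / 2)))) = ?F * (1 / 4) ^ l * (1 / 4) ^ i"
        by (simp only: Q_def distrib_left exp_add power_add mult_ac)
      finally show ?thesis .
    qed
  qed
  have geo: "(\<lambda>i. ?F * (1 / 4) ^ l * (1 / 4) ^ i) sums (?F * (1 / 4) ^ l * (1 / (1 - 1 / 4)))"
    by (intro sums_mult geometric_sums) auto
  have "norm (shift_op (T R) (\<lambda>n. binom_exp (\<alpha> j * q ^ k) \<sigma> (n + l) * G l n) N) \<le> ?F * (1 / 4) ^ l * (1 / (1 - 1 / 4))"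
    using norm_suminf_le[OF bound sums_summable[OF geo]] sums_unique[OF fs] sums_unique[OF geo] by simp
  \<comment> \<open>The factor \<open>4 / 3\<close> of the geometric sum is absorbed by half of the
    decay in \<open>l\<close>, because \<open>l \<ge> 1\<close>.\<close>
  also have "\<dots> \<le> ?F * (1 / 2) ^ l"
  proof -
    have "(1 / 4 :: real) ^ l = (1 / 2) ^ l * (1 / 2) ^ l" by (simp flip: power_mult_distrib)
    moreover have "(1 / 2 :: real) ^ l \<le> 1 / 2" using \<open>l > 0\<close> by (cases l) (auto simp: power_le_one)
    ultimately have "(1 / 4 :: real) ^ l \<le> (1 / 2) ^ l * (1 / 2)"
      by (metis mult_left_mono zero_le_divide_1_iff zero_le_numeral zero_le_power)
    moreover have "0 \<le> (1 / 4 :: real) ^ l" by simp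
    moreover have "(1 / 4) ^ l * (1 / (1 - 1 / 4)) = (4 / 3 :: real) * (1 / 4) ^ l" by simp
    ultimately have "(1 / 4) ^ l * (1 / (1 - 1 / 4)) \<le> (1 / 2 :: real) ^ l"
      by linarith
    from mult_left_mono[OF this F0] show ?thesis by (simp only: mult.assoc)
  qed
  finally show ?thesis .
qed

text \<open>The previous bound is summed over \<open>idx\<close> and over \<open>l\<close>. The
  coefficients cost a factor \<open>H\<close>, and all linear exponents go into
  \<open>K'\<close>.\<close>

lemma shift_op_T_tail_bound:
  fixes c :: "nat \<Rightarrow> nat \<Rightarrow> complex" and K \<epsilon> :: real
  assumes sums: "\<And>l n. N1 \<le> n \<Longrightarrow> (\<lambda>i. c l i * (1 / q ^ n) ^ (d * l + i)) sums G l n"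
    and c: "\<And>l i. norm (c l i) \<le> K ^ (d * l + i) *
              exp (- ln (norm q) * (\<epsilon> * (real (d * l + i))\<^sup>2 / (2 * real d)))"
    and K: "K \<ge> 1" and \<epsilon>: "\<epsilon> \<ge> 0"
  shows "\<exists>K'\<ge>0. \<exists>N2. \<forall>R N A H v'. N2 \<le> N \<longrightarrow> (\<forall>i\<in>idx. norm (A i) \<le> H) \<longrightarrow> 0 \<le> H \<longrightarrow>
      (\<forall>n. (\<lambda>l. u A (n + Suc l) * G (Suc l) n) sums v' n) \<longrightarrow>
     norm (shift_op (T R) v' N) \<le> H * exp (K' * (real R + real N + 1) - ln (norm q) *
        (real N * real R + real S * (real R)\<^sup>2 / 2 + \<epsilon> * (real R)\<^sup>2 / (2 * real d)))"
proof -
  define W where "W = 1 + (\<Sum>j=1..m. \<Sum>k<d. norm (\<alpha> j * q ^ k)) + (\<Sum>j=1..m. norm (\<alpha> j))"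
  define F0 where "F0 = 1 + (\<Sum>(j, k, \<sigma>)\<in>idx. fact \<sigma> :: real)"
  define Q where "Q = ln (norm q)"
  have Q: "Q > 0" using norm_q by (simp add: Q_def)
  have W: "1 + norm (\<alpha> j * q ^ k) + norm (\<alpha> i) \<le> W" if "i \<in> {1..m}" "j \<in> {1..m}" "k < d" for i j k
  proof -
    have "norm (\<alpha> j * q ^ k) \<le> (\<Sum>k<d. norm (\<alpha> j * q ^ k))"
      using that by (intro member_le_sum) auto
    also have "\<dots> \<le> (\<Sum>j=1..m. \<Sum>k<d. norm (\<alpha> j * q ^ k))"
      using that by (intro member_le_sum[of j]) (auto intro: sum_nonneg)
    finally have "norm (\<alpha> j * q ^ k) \<le> (\<Sum>j=1..m. \<Sum>k<d. norm (\<alpha> j * q ^ k))" .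
    moreover have "norm (\<alpha> i) \<le> (\<Sum>j=1..m. norm (\<alpha> j))"
      using that by (intro member_le_sum) auto
    ultimately show ?thesis unfolding W_def by linarith
  qed
  have W1: "1 \<le> W"
    unfolding W_def using sum_nonneg[of "{1..m}" "\<lambda>j. norm (\<alpha> j)"]
      sum_nonneg[of "{1..m}" "\<lambda>j. \<Sum>k<d. norm (\<alpha> j * q ^ k)"] by (simp add: sum_nonneg)
  have F0: "1 \<le> F0" by (auto simp: F0_def intro!: sum_nonneg)
  obtain N0 where N0: "4 * K * W < norm q ^ N0"
    using real_arch_pow[OF norm_q] by blast
  define K' where "K' = ln F0 + ln (4 * K * W) + ln W * (S + 1)"
  have K1: "1 \<le> 4 * K * W" using mult_mono[of 1 K 1 W] K W1 by simp
  have ln0: "ln F0 \<ge> 0" "ln (4 * K * W) \<ge> 0" "ln W \<ge> 0" using K1 F0 W1 by auto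
  show ?thesis
  proof (intro exI[of _ K'] exI[of _ "max N1 N0"] conjI allI impI)
    show "K' \<ge> 0" using ln0 by (simp add: K'_def)
    fix R N :: nat and A H v'
    assume N: "max N1 N0 \<le> N" and A: "\<forall>i\<in>idx. norm (A i) \<le> H" and H: "0 \<le> H"
      and v': "\<forall>n. (\<lambda>l. u A (n + Suc l) * G (Suc l) n) sums v' n"
    define F where "F = (4 * K * W) ^ R * W ^ (N + S * R) * exp (- Q *
        (real N * real R + real S * (real R * (real R + 1) / 2) + \<epsilon> * (real R)\<^sup>2 / (2 * real d)))"
    have "F \<ge> 0" using K1 W1 by (simp add: F_def)
    have "norm q ^ N0 \<le> norm q ^ N" using N norm_q by (intro power_increasing) auto
    then have N': "4 * K * W \<le> norm q ^ N" using N0 by linarith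
    have T: "norm (shift_op (T R) (\<lambda>n. binom_exp (\<alpha> j * q ^ k) \<sigma> (n + Suc l) * G (Suc l) n) N) \<le> F * (1 / 2) ^ Suc l"
      if "(j, k, \<sigma>) \<in> idx" for j k \<sigma> l
      unfolding F_def Q_def using that N N'
      by (intro norm_shift_op_T_tail_le[OF sums c K \<epsilon> W]) auto
    have bound: "norm (shift_op (T R) (\<lambda>n. u A (n + Suc l) * G (Suc l) n) N) \<le> H * F0 * F * (1 / 2) ^ Suc l" for l
    proof -
      have eq: "shift_op (T R) (\<lambda>n. u A (n + Suc l) * G (Suc l) n) N =
        (\<Sum>i\<in>idx. A i * fact (snd (snd i)) *
          shift_op (T R) (\<lambda>n. binom_exp (\<alpha> (fst i) * q ^ fst (snd i)) (snd (snd i)) (n + Suc l) * G (Suc l) n) N)"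
        unfolding u_def sum_distrib_right shift_op_seq_sum case_prod_unfold prod.collapse
      proof (intro sum.cong refl)
        fix i
        show "shift_op (T R) (\<lambda>n. A i * fact (snd (snd i)) *
            binom_exp (\<alpha> (fst i) * q ^ fst (snd i)) (snd (snd i)) (n + Suc l) * G (Suc l) n) N =
          A i * fact (snd (snd i)) * shift_op (T R) (\<lambda>n.
            binom_exp (\<alpha> (fst i) * q ^ fst (snd i)) (snd (snd i)) (n + Suc l) * G (Suc l) n) N"
          by (subst shift_op_cmult[symmetric]) (simp only: mult.assoc)
      qed
      have "norm (shift_op (T R) (\<lambda>n. u A (n + Suc l) * G (Suc l) n) N) \<le>
          (\<Sum>i\<in>idx. H * fact (snd (snd i)) * (F * (1 / 2) ^ Suc l))"
        unfolding eq
      proof (intro sum_norm_le)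
        fix i assume i: "i \<in> idx"
        show "norm (A i * fact (snd (snd i)) *
          shift_op (T R) (\<lambda>n. binom_exp (\<alpha> (fst i) * q ^ fst (snd i)) (snd (snd i)) (n + Suc l) * G (Suc l) n) N)
          \<le> H * fact (snd (snd i)) * (F * (1 / 2) ^ Suc l)"
          unfolding norm_mult norm_fact
        proof (intro mult_mono)
          show "norm (A i) \<le> H" using A i by blast
          show "norm (shift_op (T R) (\<lambda>n. binom_exp (\<alpha> (fst i) * q ^ fst (snd i)) (snd (snd i)) (n + Suc l) * G (Suc l) n) N)
              \<le> F * (1 / 2) ^ Suc l"
            by (rule T) (use i in simp)
        qed (use H in \<open>simp_all add: mult_nonneg_nonneg\<close>)
      qed
      also have "\<dots> = (\<Sum>i\<in>idx. fact (snd (snd i))) * (H * (F * (1 / 2) ^ Suc l))"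
        unfolding sum_distrib_right by (intro sum.cong refl) (simp only: mult_ac)
      also have "\<dots> \<le> F0 * (H * (F * (1 / 2) ^ Suc l))"
        using H \<open>F \<ge> 0\<close>
        by (intro mult_right_mono mult_nonneg_nonneg) (simp_all add: F0_def case_prod_unfold)
      finally show ?thesis by (simp add: mult_ac)
    qed
    have vs: "(\<lambda>l. shift_op (T R) (\<lambda>n. u A (n + Suc l) * G (Suc l) n) N) sums shift_op (T R) v' N"
      using v' by (intro shift_op_sums) auto
    have geo: "(\<lambda>l. H * F0 * F * (1 / 2) ^ Suc l) sums (H * F0 * F * 1)"
      by (intro sums_mult power_half_series)
    have "norm (shift_op (T R) v' N) \<le> H * (F0 * F)"
      using norm_suminf_le[OF bound sums_summable[OF geo]] sums_unique[OF vs] sums_unique[OF geo]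
      by (simp add: mult.assoc)
    also have "F0 * F \<le> exp (K' * (real R + real N + 1) - Q *
        (real N * real R + real S * (real R)\<^sup>2 / 2 + \<epsilon> * (real R)\<^sup>2 / (2 * real d)))"
    proof -
      have "F0 * F = exp (ln F0 + (ln (4 * K * W) * R + (ln W * (N + S * R) - Q *
        (real N * real R + real S * (real R * (real R + 1) / 2) + \<epsilon> * (real R)\<^sup>2 / (2 * real d)))))"
      proof -
        have *: "exp (ln F0) = F0" "exp (ln (4 * K * W) * R) = (4 * K * W) ^ R"
          "exp (ln W * (N + S * R)) = W ^ (N + S * R)"
          using F0 K1 W1 by (simp_all add: exp_of_nat2_mult del: of_nat_add of_nat_mult)
        show ?thesis
          unfolding F_def diff_conv_add_uminus exp_add * by (simp only: mult_minus_left mult.assoc)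
      qed
      also have "\<dots> \<le> exp (K' * (real R + real N + 1) - Q *
        (real N * real R + real S * (real R)\<^sup>2 / 2 + \<epsilon> * (real R)\<^sup>2 / (2 * real d)))"
      proof -
        define n where "n = real R + real N + 1"
        have "n \<ge> 1" by (simp add: n_def)
        have 1: "ln F0 \<le> ln F0 * n" using ln0 \<open>n \<ge> 1\<close> by (simp add: mult_le_cancel_left1)
        have 2: "ln (4 * K * W) * R \<le> ln (4 * K * W) * n"
          using ln0(2) by (intro mult_left_mono) (auto simp: n_def)
        have "N + S * R \<le> (S + 1) * (R + N + 1)" by (simp add: algebra_simps)
        then have "real (N + S * R) \<le> real ((S + 1) * (R + N + 1))"
          by (rule of_nat_mono)
        also have "\<dots> = real (S + 1) * n"
          by (simp add: n_def algebra_simps)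
        finally have "real (N + S * R) \<le> real (S + 1) * n" .
        then have 3: "ln W * (N + S * R) \<le> ln W * (real (S + 1) * n)"
          using ln0(3) by (rule mult_left_mono)
        have "Q * (real N * real R + real S * (real R)\<^sup>2 / 2 + \<epsilon> * (real R)\<^sup>2 / (2 * real d))
          \<le> Q * (real N * real R + real S * (real R * (real R + 1) / 2) + \<epsilon> * (real R)\<^sup>2 / (2 * real d))"
          using Q by (intro mult_left_mono) (auto simp: power2_eq_square distrib_left field_simps)
        moreover have "K' * n = ln F0 * n + ln (4 * K * W) * n + ln W * (real (S + 1) * n)"
          by (simp add: K'_def algebra_simps)
        ultimately show ?thesis using 1 2 3 unfolding n_def[symmetric] exp_le_cancel_iff by linarith
      qed
      finally show ?thesis .
    qed
    finally show "norm (shift_op (T R) v' N) \<le> H * exp (K' * (real R + real N + 1) - ln (norm q) *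
        (real N * real R + real S * (real R)\<^sup>2 / 2 + \<epsilon> * (real R)\<^sup>2 / (2 * real d)))"
      using H by (simp add: Q_def mult_left_mono)
  qed
qed

section \<open>The series, and the expansion of \<open>G\<close> in powers of
  \<open>1 / q ^ n\<close>\<close>

definition series :: "complex \<Rightarrow> complex" where
  "series z = (\<Sum>n. z ^ n / P_prod n)"

lemma G_eq_P_prod: "G l n = P_prod n / P_prod (n + l)"
proof (induction l)
  case (Suc l)
  then show ?case
    using P_nz[of "Suc (n + l)"] by (simp add: G_def P_prod_Suc field_simps del: power_Suc)
qed (simp add: G_def)

text \<open>For the reflected polynomial \<open>R\<close> and \<open>z = 1 / q ^ n\<close>,
  \<open>G l n\<close> is \<open>z ^ (d * l)\<close> times the function \<open>F l\<close> at
  \<open>z\<close>. As \<open>z / q ^ i\<close> is no larger than \<open>z\<close>, all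
  \<open>F l\<close> are holomorphic on a common disc with a bound geometric in \<open>l\<close>,
  and Cauchy's inequality controls their Taylor coefficients.\<close>

lemma expansion_general:
  "\<exists>K\<ge>1. \<exists>N1 c. (\<forall>l n. N1 \<le> n \<longrightarrow> (\<lambda>i. c l i * (1 / q ^ n) ^ (d * l + i)) sums G l n) \<and>
     (\<forall>l i. norm (c l i) \<le> K ^ (d * l + i))"
proof -
  define R where "R = reflect_poly P"
  define p where "p = norm (lead_coeff P)"
  have p: "p > 0" using d_def d_pos by (auto simp: p_def)
  \<comment> \<open>The value of \<open>R\<close> at 0 is the leading coefficient of
    \<open>P\<close>, so by continuity \<open>R\<close> stays at least \<open>p / 2\<close> in
    modulus near 0.\<close>
  have "isCont (poly R) 0" by simp
  then obtain \<delta> where \<delta>: "\<delta> > 0" "\<And>y. dist y 0 < \<delta> \<Longrightarrow> dist (poly R y) (poly R 0) < p / 2"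
    unfolding continuous_at_eps_delta using p by (metis half_gt_zero)
  have R_lower: "p / 2 \<le> norm (poly R y)" if "norm y < \<delta>" for y
  proof -
    have "dist (poly R y) (lead_coeff P) < p / 2"
      using \<delta>(2)[of y] that by (simp add: R_def)
    then show ?thesis
      using norm_triangle_ineq2[of "lead_coeff P" "lead_coeff P - poly R y"]
      by (simp add: p_def dist_norm norm_minus_commute)
  qed
  define F where "F l z = (\<Prod>i=1..l. 1 / (q ^ (d * i) * poly R (z / q ^ i)))" for l z
  have div: "norm (z / q ^ i) \<le> norm z" for z i
    using norm_q by (simp add: norm_divide norm_power divide_le_eq mult_le_cancel_left1)
  have R_nz: "poly R (z / q ^ i) \<noteq> 0" if "norm z < \<delta>" for z i
    using R_lower[of "z / q ^ i"] div[of z i] that p by auto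
  define \<rho> where "\<rho> = \<delta> / 2"
  have \<rho>: "0 < \<rho>" "\<rho> < \<delta>" using \<delta> by (auto simp: \<rho>_def)
  have hol: "F l holomorphic_on ball 0 \<delta>" for l
    unfolding F_def using R_nz by (intro holomorphic_intros) auto
  have F_bound: "norm (F l z) \<le> (2 / p) ^ l" if "norm z < \<delta>" for l z
  proof -
    have "norm (F l z) \<le> (\<Prod>i=1..l. 2 / p)"
      unfolding F_def prod_norm[symmetric]
    proof (intro prod_mono conjI norm_ge_zero)
      fix i
      have "p / 2 \<le> norm (poly R (z / q ^ i))"
        using R_lower[of "z / q ^ i"] div[of z i] that by auto
      moreover have "1 \<le> norm q ^ (d * i)" using norm_q by (intro one_le_power) auto
      ultimately have "1 * (p / 2) \<le> norm q ^ (d * i) * norm (poly R (z / q ^ i))"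
        using p by (intro mult_mono) auto
      then show "norm (1 / (q ^ (d * i) * poly R (z / q ^ i))) \<le> 2 / p"
        using p by (simp add: norm_divide norm_mult norm_power divide_simps)
    qed
    then show ?thesis by simp
  qed
  define c where "c l i = (deriv ^^ i) (F l) 0 / fact i" for l i
  define K where "K = max 1 (max (2 / p) (1 / \<rho>))"
  have "norm (c l i) \<le> K ^ (d * l + i)" for l i
  proof -
    have "norm ((deriv ^^ i) (F l) 0) \<le> fact i * (2 / p) ^ l / \<rho> ^ i"
    proof (rule Cauchy_inequality)
      show "F l holomorphic_on ball 0 \<rho>" using hol by (rule holomorphic_on_subset) (use \<rho> in auto)
      show "continuous_on (cball 0 \<rho>) (F l)"
        by (rule holomorphic_on_imp_continuous_on, rule holomorphic_on_subset[OF hol]) (use \<rho> in auto)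
    qed (use \<rho> F_bound in auto)
    then have "norm (c l i) \<le> (2 / p) ^ l * (1 / \<rho>) ^ i"
      by (simp add: c_def norm_divide field_simps)
    also have "\<dots> \<le> K ^ l * K ^ i"
      using p \<rho> by (intro mult_mono power_mono) (auto simp: K_def)
    also have "\<dots> \<le> K ^ (d * l + i)"
      unfolding power_add[symmetric] using d_pos by (intro power_increasing) (auto simp: K_def)
    finally show ?thesis .
  qed
  moreover obtain N1 where N1: "1 / \<rho> < norm q ^ N1"
    using real_arch_pow[OF norm_q] by blast
  have "(\<lambda>i. c l i * (1 / q ^ n) ^ (d * l + i)) sums G l n" if "N1 \<le> n" for l n
  proof -
    have "norm q ^ N1 \<le> norm q ^ n" using that norm_q by (intro power_increasing) auto
    then have "1 / \<rho> < norm q ^ n" using N1 by linarith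
    then have small: "norm (1 / q ^ n) < \<rho>"
      using \<rho> norm_q by (simp add: norm_divide norm_power field_simps)
    then have "(\<lambda>i. (deriv ^^ i) (F l) 0 / fact i * (1 / q ^ n - 0) ^ i) sums F l (1 / q ^ n)"
      using \<rho> by (intro holomorphic_power_series[OF hol]) auto
    from sums_mult[OF this, of "(1 / q ^ n) ^ (d * l)"]
    have "(\<lambda>i. c l i * (1 / q ^ n) ^ (d * l + i)) sums ((1 / q ^ n) ^ (d * l) * F l (1 / q ^ n))"
      by (simp add: c_def power_add mult_ac)
    also have "(1 / q ^ n) ^ (d * l) * F l (1 / q ^ n) = (\<Prod>i=1..l. (1 / q ^ n) ^ d * (1 / (q ^ (d * i) * poly R (1 / q ^ n / q ^ i))))"
      unfolding prod.distrib F_def by (simp add: power_mult)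
    also have "\<dots> = (\<Prod>i=1..l. 1 / poly P (q ^ (n + i)))"
    proof (intro prod.cong refl)
      fix i
      have "poly R (1 / q ^ n / q ^ i) = (1 / q ^ (n + i)) ^ d * poly P (q ^ (n + i))"
        unfolding R_def d_def by (subst poly_reflect_poly_nz) (auto simp: power_add field_simps)
      then show "(1 / q ^ n) ^ d * (1 / (q ^ (d * i) * poly R (1 / q ^ n / q ^ i))) = 1 / poly P (q ^ (n + i))"
        by (simp add: power_add power_mult_distrib power_divide flip: power_mult)
           (simp add: field_simps)
    qed
    also have "\<dots> = G l n" by (simp add: G_def prod_dividef)
    finally show ?thesis .
  qed
  ultimately show ?thesis
    by (intro exI[of _ K] conjI exI[of _ N1] exI[of _ c]) (auto simp: K_def)
qed

text \<open>
  The extra decay of the coefficients in the monomial case is what improves \<open>M\<close>; in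
  \<open>shift_op_T_tail_bound\<close> both cases are covered through the weight \<open>\<epsilon> \<in> {0, 1}\<close>.
\<close>

lemma expansion_monomial:
  assumes P: "P = monom p d" "p \<noteq> 0"
  shows "\<exists>K\<ge>1. \<exists>N1 c. (\<forall>l n. N1 \<le> n \<longrightarrow> (\<lambda>i. c l i * (1 / q ^ n) ^ (d * l + i)) sums G l n) \<and>
     (\<forall>l i. norm (c l i) \<le> K ^ (d * l + i) * exp (- ln (norm q) * ((real (d * l + i))\<^sup>2 / (2 * real d))))"
proof -
  define K where "K = max 1 (1 / norm p)"
  \<comment> \<open>Here \<open>G l n\<close> is a single power of \<open>1 / q ^ n\<close>, so only
    \<open>i = 0\<close> contributes.\<close>
  define c where "c l i = (if i = 0 then \<Prod>i=1..l. 1 / (p * q ^ (d * i)) else 0)" for l i :: nat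
  have "(\<lambda>i. c l i * (1 / q ^ n) ^ (d * l + i)) sums G l n" for l n
  proof -
    have "(\<lambda>i. c l i * (1 / q ^ n) ^ (d * l + i)) sums (\<Sum>i\<in>{0}. c l i * (1 / q ^ n) ^ (d * l + i))"
      by (rule sums_finite) (auto simp: c_def)
    also have "(\<Sum>i\<in>{0}. c l i * (1 / q ^ n) ^ (d * l + i)) = (\<Prod>i=1..l. 1 / (p * q ^ (d * i)) * (1 / q ^ n) ^ d)"
      unfolding prod.distrib by (simp add: c_def power_mult)
    also have "\<dots> = (\<Prod>i=1..l. 1 / poly P (q ^ (n + i)))"
      by (intro prod.cong refl)
         (simp add: P poly_monom power_add power_mult_distrib power_divide mult.commute flip: power_mult)
    also have "\<dots> = G l n" by (simp add: G_def prod_dividef)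
    finally show ?thesis .
  qed
  moreover have "norm (c l i) \<le> K ^ (d * l + i) * exp (- ln (norm q) * ((real (d * l + i))\<^sup>2 / (2 * real d)))" for l i
  proof (cases "i = 0")
    case True
    have eq: "(\<Prod>i=1..l. 1 / norm q ^ (d * i)) = exp (- ln (norm q) * (real d * (real l * (real l + 1) / 2)))"
    proof (induction l)
      case (Suc l)
      have "1 / norm q ^ (d * Suc l) = exp (- ln (norm q) * (real d * real (Suc l)))"
        by (simp add: norm_q_power exp_minus inverse_eq_divide del: mult_Suc_right of_nat_Suc)
      then show ?case
        using Suc by (simp add: exp_add[symmetric] del: mult_Suc_right of_nat_Suc) (simp add: field_simps)
    qed simp
    have "norm (c l i) = (1 / norm p) ^ l * exp (- ln (norm q) * (real d * (real l * (real l + 1) / 2)))"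
      using True unfolding eq[symmetric]
      by (simp add: c_def prod_norm[symmetric] norm_divide norm_mult norm_power prod_dividef prod.distrib power_divide)
    also have "\<dots> \<le> K ^ (d * l + i) * exp (- ln (norm q) * ((real (d * l + i))\<^sup>2 / (2 * real d)))"
    proof (intro mult_mono)
      have "(1 / norm p) ^ l \<le> K ^ l" by (intro power_mono) (auto simp: K_def)
      also have "\<dots> \<le> K ^ (d * l + i)" using d_pos True by (intro power_increasing) (auto simp: K_def)
      finally show "(1 / norm p) ^ l \<le> K ^ (d * l + i)" .
      \<comment> \<open>With \<open>i = 0\<close> the left side is \<open>d * l^2 / 2\<close>, so
        the product over \<open>1 / q ^ (d * i)\<close> decays at least as fast as required.\<close>
      have "(real (d * l + i))\<^sup>2 / (2 * real d) \<le> real d * (real l * (real l + 1) / 2)"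
        using True d_pos by (simp add: power2_eq_square field_simps)
      moreover have "ln (norm q) > 0" using norm_q by simp
      ultimately show "exp (- ln (norm q) * (real d * (real l * (real l + 1) / 2)))
          \<le> exp (- ln (norm q) * ((real (d * l + i))\<^sup>2 / (2 * real d)))"
        by (simp only: exp_le_cancel_iff mult_minus_left neg_le_iff_le mult_le_cancel_left_pos)
    qed (auto simp: K_def)
    finally show ?thesis .
  qed (auto simp: c_def K_def)
  ultimately show ?thesis
    by (intro exI[of _ K] conjI exI[of _ 0] exI[of _ c]) (auto simp: K_def)
qed

section \<open>Derivatives of the series and the tail of the linear form\<close>

lemma summable_series: "summable (\<lambda>n. 1 / P_prod n * z ^ n)"
proof -
  obtain a p where ap: "P = pCons a p" by (cases P)
  then have "p \<noteq> 0" using d_def d_pos by auto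
  then obtain r where r: "\<And>x. r \<le> norm x \<Longrightarrow> 2 * norm z + 1 \<le> norm (poly P x)"
    using poly_infinity[of p "2 * norm z + 1" a] ap by auto
  obtain N where N: "r < norm q ^ N"
    using real_arch_pow[OF norm_q] by blast
  have "norm (1 / P_prod (Suc n) * z ^ Suc n) \<le> 1 / 2 * norm (1 / P_prod n * z ^ n)" if "N \<le> n" for n
  proof -
    have "norm q ^ N \<le> norm q ^ Suc n" using that norm_q by (intro power_increasing) auto
    then have "2 * norm z + 1 \<le> norm (poly P (q ^ Suc n))"
      using N by (intro r) (simp add: norm_power norm_mult)
    then have "norm z / norm (poly P (q ^ Suc n)) \<le> 1 / 2"
      by (simp add: divide_le_eq)
    from mult_right_mono[OF this norm_ge_zero[of "1 / P_prod n * z ^ n"]] show ?thesis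
      by (simp add: P_prod_Suc norm_divide norm_mult norm_power mult_ac)
  qed
  then show ?thesis by (intro summable_ratio_test[of "1 / 2" N]) auto
qed

lemma higher_deriv_power_series:
  fixes c :: "nat \<Rightarrow> complex"
  assumes "\<And>z. summable (\<lambda>n. c n * z ^ n)"
  shows "(deriv ^^ \<sigma>) (\<lambda>z. \<Sum>n. c n * z ^ n) = (\<lambda>z. \<Sum>n. (diffs ^^ \<sigma>) c n * z ^ n)
    \<and> (\<forall>z. summable (\<lambda>n. (diffs ^^ \<sigma>) c n * z ^ n))"
proof (induction \<sigma>)
  case (Suc \<sigma>)
  then have s: "summable (\<lambda>n. (diffs ^^ \<sigma>) c n * z ^ n)" for z by blast
  have "deriv (\<lambda>z. \<Sum>n. (diffs ^^ \<sigma>) c n * z ^ n) z = (\<Sum>n. diffs ((diffs ^^ \<sigma>) c) n * z ^ n)" for z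
    by (rule DERIV_imp_deriv, rule termdiffs_strong_converges_everywhere, rule s)
  moreover have "summable (\<lambda>n. diffs ((diffs ^^ \<sigma>) c) n * z ^ n)" for z
    by (rule termdiff_converges_all, rule s)
  ultimately show ?case
    unfolding funpow.simps o_def using Suc by simp
qed (use assms in auto)

lemma diffs_iterate: "(diffs ^^ \<sigma>) c n = fact \<sigma> * of_nat ((n + \<sigma>) choose \<sigma>) * (c (n + \<sigma>) :: complex)"
proof (induction \<sigma> arbitrary: n)
  case (Suc \<sigma>)
  have "Suc n * (Suc (\<sigma> + n) choose \<sigma>) = Suc \<sigma> * (Suc (\<sigma> + n) choose Suc \<sigma>)"
    by (rule Suc_times_binomial_add[symmetric])
  then have eq: "of_nat (Suc n) * of_nat (Suc (\<sigma> + n) choose \<sigma>) =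
      (of_nat (Suc \<sigma>) * of_nat (Suc (\<sigma> + n) choose Suc \<sigma>) :: complex)"
    by (metis of_nat_mult)
  have "(diffs ^^ Suc \<sigma>) c n = of_nat (Suc n) * of_nat (Suc (\<sigma> + n) choose \<sigma>) * (fact \<sigma> * c (Suc n + \<sigma>))"
    using Suc[of "Suc n"]
    by (simp add: diffs_def[of "(diffs ^^ \<sigma>) c"] mult_ac add.commute del: of_nat_Suc binomial_Suc_Suc)
  then show ?case unfolding eq
    by (simp add: mult_ac add.commute del: of_nat_Suc binomial_Suc_Suc)
qed simp

lemma series_deriv_sums:
  "(\<lambda>n. fact \<sigma> * binom_exp z \<sigma> n / P_prod n) sums (deriv ^^ \<sigma>) series z"
proof -
  have eq: "series = (\<lambda>z. \<Sum>n. 1 / P_prod n * z ^ n)" by (simp add: series_def fun_eq_iff)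
  note D = higher_deriv_power_series[OF summable_series, of \<sigma>]
  have "(\<lambda>n. (diffs ^^ \<sigma>) (\<lambda>n. 1 / P_prod n) n * z ^ n) sums (deriv ^^ \<sigma>) series z"
    unfolding eq using D by (auto intro: summable_sums)
  then have "(\<lambda>n. fact \<sigma> * binom_exp z \<sigma> (n + \<sigma>) / P_prod (n + \<sigma>)) sums (deriv ^^ \<sigma>) series z"
    by (simp add: diffs_iterate binom_exp_def mult_ac)
  then show ?thesis
    \<comment> \<open>The terms with \<open>n < \<sigma>\<close> vanish through the binomial
      coefficient, so shifting the summation index does not change the sum.\<close>
    by (subst (asm) sums_zero_iff_shift) (auto simp: binom_exp_def binomial_eq_0)
qed

definition lin_form :: "complex \<Rightarrow> (nat \<times> nat \<times> nat \<Rightarrow> complex) \<Rightarrow> complex" where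
  "lin_form A0 A = A0 + (\<Sum>(j, k, \<sigma>)\<in>idx. A (j, k, \<sigma>) * (deriv ^^ \<sigma>) series (\<alpha> j * q ^ k))"

lemma u_sums: "(\<lambda>n. u A n / P_prod n) sums (lin_form A0 A - A0)"
proof -
  have "(\<lambda>n. \<Sum>i\<in>idx. A i * (fact (snd (snd i)) * binom_exp (\<alpha> (fst i) * q ^ fst (snd i)) (snd (snd i)) n / P_prod n)) sums
      (\<Sum>i\<in>idx. A i * (deriv ^^ snd (snd i)) series (\<alpha> (fst i) * q ^ fst (snd i)))"
    by (intro sums_sum sums_mult series_deriv_sums)
  then show ?thesis
    by (simp add: u_def lin_form_def case_prod_unfold sum_divide_distrib mult.assoc)
qed

lemma v_eq: "v A0 A n = P_prod n * (A0 + (\<Sum>l\<le>n. u A l / P_prod l))"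
proof (induction n)
  case (Suc n)
  show ?case using P_prod_nz[of "Suc n"]
    by (simp add: Suc distrib_left P_prod_Suc[symmetric] mult.assoc[symmetric] del: power_Suc)
qed (simp add: P_prod_def)

text \<open>By \<open>v_eq\<close> the difference is \<open>P_prod n\<close> times the remainder of
  the series after index \<open>n\<close>, and each weight is the quotient described by
  \<open>G_eq_P_prod\<close>.\<close>

lemma tail_sums: "(\<lambda>l. u A (n + Suc l) * G (Suc l) n) sums (P_prod n * lin_form A0 A - v A0 A n)"
proof -
  have "(\<lambda>l. u A (l + Suc n) / P_prod (l + Suc n)) sums (lin_form A0 A - A0 - (\<Sum>l<Suc n. u A l / P_prod l))"
    by (rule sums_split_initial_segment[OF u_sums])
  from sums_mult[OF this, of "P_prod n"] show ?thesis
    by (simp add: G_eq_P_prod v_eq lessThan_Suc_atMost algebra_simps)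
qed

end

section \<open>The lower bound\<close>

text \<open>The choice \<open>R = sqrt (ln H / \<delta>) + O(1)\<close> makes the first summand at most \<open>1 / 2\<close>.\<close>

lemma lower_bound_from_sequence:
  fixes \<delta> \<eta> c :: real
  assumes "\<delta> > 0" "\<eta> \<ge> 0" "c \<ge> 0"
  shows "\<exists>C>0. \<forall>H \<Lambda>. 2 \<le> H \<longrightarrow>
    (\<forall>R::nat. 1 \<le> H * exp (c * (real R + 1) - \<delta> * (real R)\<^sup>2) + \<Lambda> * exp (c * (real R + 1) + \<eta> * (real R)\<^sup>2)) \<longrightarrow>
    H powr (- (\<eta> / \<delta>) - C / sqrt (ln H)) \<le> \<Lambda>"
proof -
  \<comment> \<open>Chosen so that \<open>\<delta> * t \<ge> 2 * c + 1\<close>: at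
    \<open>R = \<rho> + y\<close> with \<open>y \<ge> t\<close> the quadratic gain then beats the
    linear loss with 1 to spare.\<close>
  define t where "t = 1 + (2 * c + 1) / \<delta>"
  have t: "t \<ge> 1" "\<delta> * t \<ge> 2 * c + 1" using assms by (auto simp: t_def field_simps)
  \<comment> \<open>\<open>a\<close> and \<open>e\<close> are the coefficients of
    \<open>\<rho>\<close> and of 1 in \<open>1 + c * (R + 1) + \<eta> * R^2\<close> at the upper
    estimate \<open>R = \<rho> + (t + 1)\<close>.\<close>
  define a where "a = 2 * \<eta> * (t + 1) + c"
  define e where "e = \<eta> * (t + 1)\<^sup>2 + c * (t + 2) + 1"
  have ae: "a \<ge> 0" "e \<ge> 1" using assms t by (auto simp: a_def e_def)
  \<comment> \<open>\<open>sqrt \<delta>\<close> enters through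
    \<open>\<rho> = sqrt (h / \<delta>)\<close>. Dividing by \<open>sqrt (ln 2)\<close> turns the
    constant \<open>e\<close> into a multiple of \<open>sqrt (ln H)\<close>, as
    \<open>H \<ge> 2\<close>.\<close>
  define C where "C = a / sqrt \<delta> + e / sqrt (ln 2)"
  have "C > 0"
    unfolding C_def using ae assms by (intro add_nonneg_pos divide_nonneg_pos divide_pos_pos) auto
  moreover have "H powr (- (\<eta> / \<delta>) - C / sqrt (ln H)) \<le> \<Lambda>"
    if H: "2 \<le> H" and
      le: "\<And>R::nat. 1 \<le> H * exp (c * (real R + 1) - \<delta> * (real R)\<^sup>2) + \<Lambda> * exp (c * (real R + 1) + \<eta> * (real R)\<^sup>2)"
    for H \<Lambda> :: real
  proof -
    define h where "h = ln H"
    have h: "h \<ge> ln 2" "h > 0" using H by (auto simp: h_def)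
    define \<rho> where "\<rho> = sqrt (h / \<delta>)"
    have \<rho>: "\<rho> \<ge> 0" "\<delta> * \<rho>\<^sup>2 = h" using h assms by (auto simp: \<rho>_def)
    define R where "R = nat \<lceil>\<rho> + t\<rceil>"
    have R: "\<rho> + t \<le> real R" "real R \<le> \<rho> + (t + 1)"
      using \<rho> t by (auto simp: R_def) linarith+
    have "h + 1 \<le> \<delta> * (real R)\<^sup>2 - c * (real R + 1)"
    proof -
      define y where "y = real R - \<rho>"
      have y: "t \<le> y" "1 \<le> y" using R t by (auto simp: y_def)
      have "\<delta> * t \<le> \<delta> * y" using y assms by (intro mult_left_mono) auto
      then have dy: "2 * c + 1 \<le> \<delta> * y" using t by linarith
      have "1 * (c + 1) \<le> y * (\<delta> * y - c)"
        using y dy assms by (intro mult_mono) auto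
      moreover have "0 \<le> \<rho> * (2 * (\<delta> * y) - c)"
        using \<rho> dy assms by (intro mult_nonneg_nonneg) auto
      moreover have "\<delta> * (real R)\<^sup>2 - c * (real R + 1) =
          \<delta> * \<rho>\<^sup>2 + \<rho> * (2 * (\<delta> * y) - c) + y * (\<delta> * y - c) - c"
        by (simp add: y_def power2_eq_square algebra_simps)
      then have "\<delta> * (real R)\<^sup>2 - c * (real R + 1) =
          h + \<rho> * (2 * (\<delta> * y) - c) + y * (\<delta> * y - c) - c"
        by (simp only: \<rho>)
      ultimately show ?thesis by simp
    qed
    then have "H * exp (c * (real R + 1) - \<delta> * (real R)\<^sup>2) \<le> exp h * exp (- h - 1)"
      using H by (intro mult_mono) (auto simp: h_def)
    also have "\<dots> = exp (- 1)" by (simp flip: exp_add)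
    also have "exp (- 1) \<le> 1 / (2 :: real)"
      using exp_ge_add_one_self[of 1] by (simp add: exp_minus field_simps)
    finally have "1 / 2 \<le> \<Lambda> * exp (c * (real R + 1) + \<eta> * (real R)\<^sup>2)"
      using le[of R] by linarith
    moreover have "exp (- 1) \<le> 1 / (2 :: real)" by fact
    moreover define X where "X = c * (real R + 1) + \<eta> * (real R)\<^sup>2"
    ultimately have "exp (- 1) * exp (- X) \<le> \<Lambda> * exp X * exp (- X)"
      by (intro mult_right_mono) auto
    also have "\<dots> = \<Lambda>" by (simp add: mult.assoc flip: exp_add)
    also have "exp (- 1) * exp (- X) = exp (- (1 + c * (real R + 1) + \<eta> * (real R)\<^sup>2))"
      unfolding exp_add[symmetric] X_def by (simp only: minus_add_distrib add.assoc)
    finally have 1: "exp (- (1 + c * (real R + 1) + \<eta> * (real R)\<^sup>2)) \<le> \<Lambda>" .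
    have "1 + c * (real R + 1) + \<eta> * (real R)\<^sup>2 \<le> 1 + c * (\<rho> + (t + 1) + 1) + \<eta> * (\<rho> + (t + 1))\<^sup>2"
      using R assms \<rho> t by (intro add_mono mult_left_mono power_mono) auto
    also have "\<dots> = \<eta> * \<rho>\<^sup>2 + a * \<rho> + e"
      by (simp add: a_def e_def power2_eq_square algebra_simps)
    also have "\<dots> \<le> \<eta> / \<delta> * h + C * sqrt h"
    proof -
      have "\<eta> * \<rho>\<^sup>2 = \<eta> / \<delta> * h" using h assms by (simp add: \<rho>_def)
      moreover have "a * \<rho> = a / sqrt \<delta> * sqrt h" by (simp add: \<rho>_def real_sqrt_divide)
      moreover have "e \<le> e / sqrt (ln 2) * sqrt h"
      proof -
        have "sqrt (ln 2) \<le> sqrt h" "sqrt (ln 2) > 0" using h by auto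
        then have "1 \<le> sqrt h / sqrt (ln 2)" by (simp add: field_simps)
        from mult_left_mono[OF this, of e] show ?thesis using ae by simp
      qed
      ultimately show ?thesis by (simp add: C_def distrib_right)
    qed
    finally have "exp (- (\<eta> / \<delta> * h + C * sqrt h)) \<le> exp (- (1 + c * (real R + 1) + \<eta> * (real R)\<^sup>2))"
      by simp
    moreover have "H powr (- (\<eta> / \<delta>) - C / sqrt (ln H)) = exp (- (\<eta> / \<delta> * h + C * sqrt h))"
    proof -
      have "C / sqrt h * h = C * sqrt h" using h by (simp add: field_simps)
      then show ?thesis
        using H unfolding powr_def h_def[symmetric] by (simp add: algebra_simps)
    qed
    ultimately show ?thesis using 1 by linarith
  qed
  ultimately show ?thesis by blast
qed

context q_rational
begin

text \<open>With \<open>N\<close> near \<open>\<tau> * R\<close>, the arithmetic lower bound for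
  \<open>T R\<close> applied to \<open>v\<close> is played off against \<open>v\<close> being
  \<open>P_prod\<close> times the form, minus the tail. \<open>- \<delta>\<close> is the resulting
  coefficient of \<open>R^2\<close> in the exponent next to \<open>H\<close>, and
  \<open>\<eta>\<close> is that in the exponent next to the linear form.\<close>

lemma lin_form_lower_bound_of_expansion:
  fixes c :: "nat \<Rightarrow> nat \<Rightarrow> complex" and K \<epsilon> \<tau> :: real
  defines "\<delta> \<equiv> ln (norm q) * (\<tau> + real S / 2 + \<epsilon> / (2 * real d)) - ln \<bar>q1\<bar> * (real S / 2)
      - ln \<bar>q2\<bar> * (real d * (\<tau> + real S)\<^sup>2 / 2)"
    and "\<eta> \<equiv> ln \<bar>q1\<bar> * (real S / 2 + real d * (\<tau> + real S)\<^sup>2 / 2)"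
  assumes sums: "\<And>l n. N1 \<le> n \<Longrightarrow> (\<lambda>i. c l i * (1 / q ^ n) ^ (d * l + i)) sums G l n"
    and c: "\<And>l i. norm (c l i) \<le> K ^ (d * l + i) *
              exp (- ln (norm q) * (\<epsilon> * (real (d * l + i))\<^sup>2 / (2 * real d)))"
    and K: "K \<ge> 1" and \<epsilon>: "\<epsilon> \<ge> 0" and \<tau>: "\<tau> > 0" and \<delta>: "\<delta> > 0"
  shows "\<exists>C>0. \<forall>H A0 A. 2 \<le> H \<longrightarrow> A0 \<in> \<int> \<longrightarrow> (\<forall>i\<in>idx. A i \<in> \<int> \<and> norm (A i) \<le> H) \<longrightarrow>
     (A0 \<noteq> 0 \<or> (\<exists>i\<in>idx. A i \<noteq> 0)) \<longrightarrow>
     H powr (- (\<eta> / \<delta>) - C / sqrt (ln H)) \<le> norm (lin_form A0 A)"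
proof -
  define Q where "Q = ln (norm q)"
  define Q1 where "Q1 = ln (real_of_int \<bar>q1\<bar>)"
  define Q2 where "Q2 = ln (real_of_int \<bar>q2\<bar>)"
  have Q2: "Q2 \<ge> 0" using q2_nz by (simp add: Q2_def)
  have Q: "Q = Q1 - Q2" "Q > 0"
    using norm_q q1_nz q2_nz by (auto simp: Q_def Q1_def Q2_def q_eq norm_divide ln_div)
  obtain Ka N2 where Ka: "Ka \<ge> 0" and tail: "\<And>R N A H v'. N2 \<le> N \<Longrightarrow> (\<forall>i\<in>idx. norm (A i) \<le> H) \<Longrightarrow> 0 \<le> H \<Longrightarrow>
      (\<forall>n. (\<lambda>l. u A (n + Suc l) * G (Suc l) n) sums v' n) \<Longrightarrow>
     norm (shift_op (T R) v' N) \<le> H * exp (Ka * (real R + real N + 1) - Q *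
        (real N * real R + real S * (real R)\<^sup>2 / 2 + \<epsilon> * (real R)\<^sup>2 / (2 * real d)))"
    using shift_op_T_tail_bound[OF sums c K \<epsilon>] unfolding Q_def by blast
  obtain Kb where Kb: "Kb \<ge> 0" and P_prod_bound: "\<And>R N. norm (shift_op (T R) P_prod N) \<le>
     exp (Kb * (real R + real N + 1) + Q * (real d * (real N + real (S * R))\<^sup>2 / 2))"
    using shift_op_T_P_prod_bound unfolding Q_def by blast
  obtain Kc where Kc: "Kc \<ge> 0" and lower: "\<And>R N A0 A. A0 \<in> \<int> \<Longrightarrow> (\<forall>i\<in>idx. A i \<in> \<int>) \<Longrightarrow> shift_op (T R) (v A0 A) N \<noteq> 0 \<Longrightarrow>
     1 \<le> exp (Kc * (real R + real N + 1) + Q1 * (real S * (real R)\<^sup>2 / 2)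
          + Q2 * (real d * (real N + real (S * R))\<^sup>2 / 2))
        * norm (shift_op (T R) (v A0 A) N)"
    using shift_op_T_v_lower unfolding Q1_def Q2_def by blast
  \<comment> \<open>\<open>B\<close> bounds \<open>N - \<tau> * R\<close>: 1 for rounding,
    \<open>N2\<close> for the range of the tail bound, \<open>d * S\<close> for the nonvanishing
    window. \<open>B2\<close> bounds the resulting error in the square, up to a factor
    \<open>R + 1\<close>.\<close>
  define B where "B = 1 + real N2 + real (d * S)"
  define B2 where "B2 = 2 * B * (\<tau> + real S) + B\<^sup>2"
  have B: "B \<ge> 0" "B2 \<ge> 0" using \<tau> by (auto simp: B_def B2_def)
  define e where "e = (Ka + Kb + Kc) * (1 + \<tau> + B) + Q1 * (real d * B2 / 2)"
  have e: "e \<ge> 0" using Ka Kb Kc B Q Q2 \<tau> by (auto simp: e_def)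
  have \<eta>: "\<eta> \<ge> 0" using Q Q2 unfolding \<eta>_def Q1_def[symmetric] by auto
  obtain C where C: "C > 0" and seq: "\<And>H \<Lambda>. 2 \<le> H \<Longrightarrow>
    (\<forall>R::nat. 1 \<le> H * exp (e * (real R + 1) - \<delta> * (real R)\<^sup>2) + \<Lambda> * exp (e * (real R + 1) + \<eta> * (real R)\<^sup>2)) \<Longrightarrow>
    H powr (- (\<eta> / \<delta>) - C / sqrt (ln H)) \<le> \<Lambda>"
    using lower_bound_from_sequence[OF \<delta> \<eta> e] by blast
  have "H powr (- (\<eta> / \<delta>) - C / sqrt (ln H)) \<le> norm (lin_form A0 A)"
    if H: "2 \<le> H" and A0: "A0 \<in> \<int>" and A: "\<forall>i\<in>idx. A i \<in> \<int> \<and> norm (A i) \<le> H"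
      and nz: "A0 \<noteq> 0 \<or> (\<exists>i\<in>idx. A i \<noteq> 0)" for H A0 A
  proof (rule seq[OF H], rule allI)
    fix R :: nat
    define \<Lambda> where "\<Lambda> = norm (lin_form A0 A)"
    define r where "r = real R + 1"
    define v' where "v' n = P_prod n * lin_form A0 A - v A0 A n" for n
    obtain N where N: "N \<in> {nat \<lceil>\<tau> * R\<rceil> + N2..nat \<lceil>\<tau> * R\<rceil> + N2 + d * S}"
      and w: "shift_op (T R) (v A0 A) N \<noteq> 0"
      using shift_op_T_v_nonzero[OF nz] by blast
    have N': "\<tau> * R \<le> N" "N \<le> \<tau> * R + B" "N2 \<le> N"
    proof -
      have "\<tau> * R \<ge> 0" using \<tau> by simp
      then have "\<tau> * R \<le> nat \<lceil>\<tau> * R\<rceil>" "nat \<lceil>\<tau> * R\<rceil> \<le> \<tau> * R + 1" by linarith+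
      moreover have "real (nat \<lceil>\<tau> * R\<rceil>) + real N2 \<le> real N" "real N \<le> real (nat \<lceil>\<tau> * R\<rceil>) + real N2 + real (d * S)"
        using N by (metis atLeastAtMost_iff of_nat_add of_nat_le_iff)+
      ultimately show "\<tau> * R \<le> N" "N \<le> \<tau> * R + B" unfolding B_def by linarith+
      show "N2 \<le> N" using N by simp
    qed
    have n: "real R + real N + 1 \<le> (1 + \<tau> + B) * r"
    proof -
      have "0 \<le> B * real R" using B by simp
      then show ?thesis using N'(2) \<tau> unfolding r_def by (simp add: algebra_simps)
    qed
    have sq: "(real N + real (S * R))\<^sup>2 \<le> (\<tau> + real S)\<^sup>2 * (real R)\<^sup>2 + B2 * r"
    proof -
      have "(real N + real (S * R))\<^sup>2 \<le> ((\<tau> + real S) * R + B)\<^sup>2"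
        using N' by (intro power_mono) (auto simp: algebra_simps)
      also have "\<dots> = (\<tau> + real S)\<^sup>2 * (real R)\<^sup>2 + (2 * B * (\<tau> + real S) * R + B\<^sup>2)"
        by (simp add: power2_eq_square algebra_simps)
      also have "2 * B * (\<tau> + real S) * R + B\<^sup>2 \<le> B2 * r"
        using B \<tau> unfolding B2_def r_def by (simp add: algebra_simps)
      finally show ?thesis by simp
    qed
    define Y where "Y = real d * (real N + real (S * R))\<^sup>2 / 2"
    have Y: "Y \<le> real d * (\<tau> + real S)\<^sup>2 / 2 * (real R)\<^sup>2 + real d * B2 / 2 * r"
      using mult_left_mono[OF sq, of "real d / 2"] by (simp add: Y_def algebra_simps add_divide_distrib)
    define n where "n = real R + real N + 1"
    define D where "D = exp (Kc * n + Q1 * (real S * (real R)\<^sup>2 / 2) + Q2 * Y)"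
    have split: "shift_op (T R) (v A0 A) N = lin_form A0 A * shift_op (T R) P_prod N - shift_op (T R) v' N"
    proof -
      have *: "v A0 A = (\<lambda>n. lin_form A0 A * P_prod n - v' n)" by (simp add: v'_def fun_eq_iff mult.commute)
      show ?thesis by (subst *) (simp only: shift_op_seq_diff shift_op_cmult)
    qed
    have "1 \<le> D * norm (shift_op (T R) (v A0 A) N)"
      using lower[OF A0 _ w] A by (simp add: D_def n_def Y_def)
    also have "norm (shift_op (T R) (v A0 A) N) \<le> \<Lambda> * norm (shift_op (T R) P_prod N) + norm (shift_op (T R) v' N)"
      unfolding split \<Lambda>_def norm_mult[symmetric] by (rule norm_triangle_ineq4)
    also have "\<dots> \<le> \<Lambda> * exp (Kb * n + Q * Y) + H * exp (Ka * n - Q *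
        (real N * real R + real S * (real R)\<^sup>2 / 2 + \<epsilon> * (real R)\<^sup>2 / (2 * real d)))"
      using tail[of N A H v' R] A H tail_sums[of A _ A0] N'(3) P_prod_bound[of R N]
      unfolding n_def Y_def \<Lambda>_def
      by (intro add_mono mult_left_mono) (auto simp: v'_def)
    finally have "1 \<le> D * (\<Lambda> * exp (Kb * n + Q * Y) + H * exp (Ka * n - Q *
        (real N * real R + real S * (real R)\<^sup>2 / 2 + \<epsilon> * (real R)\<^sup>2 / (2 * real d))))"
      by (simp add: D_def)
    also have "\<dots> = H * (D * exp (Ka * n - Q *
        (real N * real R + real S * (real R)\<^sup>2 / 2 + \<epsilon> * (real R)\<^sup>2 / (2 * real d))))
        + \<Lambda> * (D * exp (Kb * n + Q * Y))" by (simp add: algebra_simps)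
    also have "\<dots> \<le> H * exp (e * r - \<delta> * (real R)\<^sup>2) + \<Lambda> * exp (e * r + \<eta> * (real R)\<^sup>2)"
    proof (intro add_mono mult_left_mono)
      have n0: "n \<ge> 0" and r0: "r \<ge> 0" by (simp_all add: n_def r_def)
      have Kn: "(Ka + Kb + Kc) * n \<le> (Ka + Kb + Kc) * (1 + \<tau> + B) * r"
        using n Ka Kb Kc unfolding n_def by (simp only: mult.assoc) (intro mult_left_mono, auto)
      have er: "e * r = (Ka + Kb + Kc) * (1 + \<tau> + B) * r + Q1 * (real d * B2 / 2 * r)"
        by (simp add: e_def distrib_right)
      have K0: "Ka * n \<ge> 0" "Kb * n \<ge> 0" "Kc * n \<ge> 0" using Ka Kb Kc n0 by auto
      have Kn': "(Ka + Kb + Kc) * n = Ka * n + Kb * n + Kc * n" by (simp add: distrib_right)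
      have B2r: "real d * B2 / 2 * r \<ge> 0" using B r0 by simp
      have Q1Y: "Q1 * Y \<le> Q1 * (real d * (\<tau> + real S)\<^sup>2 / 2 * (real R)\<^sup>2) + Q1 * (real d * B2 / 2 * r)"
        using mult_left_mono[OF Y, of Q1] Q Q2 by (simp add: distrib_left)
      have Q2Y: "Q2 * Y \<le> Q2 * (real d * (\<tau> + real S)\<^sup>2 / 2 * (real R)\<^sup>2) + Q2 * (real d * B2 / 2 * r)"
        using mult_left_mono[OF Y Q2] by (simp add: distrib_left)
      have Q12: "Q2 * (real d * B2 / 2 * r) \<le> Q1 * (real d * B2 / 2 * r)"
        using Q B2r by (intro mult_right_mono) auto
      have "\<tau> * real R * real R \<le> real N * real R" using N' by (intro mult_right_mono) auto
      then have "Q * (\<tau> * (real R)\<^sup>2 + real S * (real R)\<^sup>2 / 2 + \<epsilon> * (real R)\<^sup>2 / (2 * real d)) \<le>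
          Q * (real N * real R + real S * (real R)\<^sup>2 / 2 + \<epsilon> * (real R)\<^sup>2 / (2 * real d))"
        using Q by (intro mult_left_mono) (auto simp: power2_eq_square)
      moreover have "\<delta> * (real R)\<^sup>2 = Q * (\<tau> * (real R)\<^sup>2 + real S * (real R)\<^sup>2 / 2 + \<epsilon> * (real R)\<^sup>2 / (2 * real d))
          - Q1 * (real S * (real R)\<^sup>2 / 2) - Q2 * (real d * (\<tau> + real S)\<^sup>2 / 2 * (real R)\<^sup>2)"
        unfolding \<delta>_def Q_def[symmetric] Q1_def[symmetric] Q2_def[symmetric]
        by (simp add: algebra_simps)
      ultimately show "D * exp (Ka * n - Q *
        (real N * real R + real S * (real R)\<^sup>2 / 2 + \<epsilon> * (real R)\<^sup>2 / (2 * real d))) \<le> exp (e * r - \<delta> * (real R)\<^sup>2)"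
        unfolding D_def exp_add[symmetric] exp_le_cancel_iff er using Q2Y Q12 Kn K0 Kn' by linarith
      \<comment> \<open>The exponent of the denominator of \<open>v\<close> and the growth of
        \<open>P_prod\<close> add up to \<open>Q1\<close>, since \<open>Q = Q1 - Q2\<close>.\<close>
      have "Q2 * Y + Q * Y = Q1 * Y" by (simp add: Q algebra_simps)
      moreover have "\<eta> * (real R)\<^sup>2 = Q1 * (real S * (real R)\<^sup>2 / 2) + Q1 * (real d * (\<tau> + real S)\<^sup>2 / 2 * (real R)\<^sup>2)"
        unfolding \<eta>_def Q1_def[symmetric] by (simp add: algebra_simps)
      ultimately show "D * exp (Kb * n + Q * Y) \<le> exp (e * r + \<eta> * (real R)\<^sup>2)"
        unfolding D_def exp_add[symmetric] exp_le_cancel_iff er using Q1Y Kn K0 Kn' by linarith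
    qed (use H in \<open>auto simp: \<Lambda>_def\<close>)
    finally show "1 \<le> H * exp (e * (real R + 1) - \<delta> * (real R)\<^sup>2) + norm (lin_form A0 A) * exp (e * (real R + 1) + \<eta> * (real R)\<^sup>2)"
      by (simp add: r_def \<Lambda>_def)
  qed
  with C show ?thesis by blast
qed

text \<open>It remains to choose \<open>\<tau>\<close>. The choice makes \<open>\<delta>\<close> and
  \<open>\<eta>\<close> share the factor \<open>Q1 * (y / d)\<close>, with cofactors
  \<open>1 - M * \<gamma>\<close> and \<open>M - 1\<close>; so \<open>\<delta>\<close> is positive
  exactly under the hypothesis on \<open>\<gamma>\<close>, and the quotient is
  \<open>\<mu>\<close>.\<close>

lemma lin_form_lower_bound:
  fixes M \<mu> \<gamma> :: real
  assumes \<gamma>: "\<gamma> = ln \<bar>q2\<bar> / ln \<bar>q1\<bar>" and S: "S > 0"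
    and M: "M = (if \<exists>p. p \<noteq> 0 \<and> P = monom p d
              then real d * real S + 1/2 + sqrt ((real d)\<^sup>2 * (real S)\<^sup>2 + 1/4)
              else real d * real S + 1 + sqrt (real d * real S * (real d * real S + 1)))"
    and \<mu>: "\<mu> = (M - 1) / (1 - M * \<gamma>)" and \<gamma>M: "\<gamma> < 1 / M"
  shows "\<exists>C>0. \<forall>H A0 A. 2 \<le> H \<longrightarrow> A0 \<in> \<int> \<longrightarrow> (\<forall>i\<in>idx. A i \<in> \<int> \<and> norm (A i) \<le> H) \<longrightarrow>
     (A0 \<noteq> 0 \<or> (\<exists>i\<in>idx. A i \<noteq> 0)) \<longrightarrow>
     H powr (- \<mu> - C / sqrt (ln H)) \<le> norm (lin_form A0 A)"
proof -
  define x where "x = real d * real S"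
  have "1 \<le> d * S" using d_pos S by (cases d) auto
  then have x: "x \<ge> 1" unfolding x_def by (metis of_nat_1 of_nat_le_iff of_nat_mult)
  define \<epsilon> :: real where "\<epsilon> = (if \<exists>p. p \<noteq> 0 \<and> P = monom p d then 1 else 0)"
  \<comment> \<open>For \<open>\<epsilon> = 1\<close> and \<open>\<epsilon> = 0\<close> this is the
    square root in the two cases of \<open>M\<close>.\<close>
  define y where "y = sqrt (x\<^sup>2 + x * (1 - \<epsilon>) + \<epsilon>\<^sup>2 / 4)"
  have \<epsilon>: "\<epsilon> \<in> {0, 1}" by (simp add: \<epsilon>_def)
  have M': "M = x + 1 - \<epsilon> / 2 + y"
  proof (cases "\<exists>p. p \<noteq> 0 \<and> P = monom p d")
    case True
    then have "\<epsilon> = 1" by (simp add: \<epsilon>_def)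
    then show ?thesis
      unfolding M if_P[OF True] y_def x_def by (simp add: power_mult_distrib)
  next
    case False
    then have "\<epsilon> = 0" by (simp add: \<epsilon>_def)
    then show ?thesis
      unfolding M if_not_P[OF False] y_def x_def by (simp add: power2_eq_square algebra_simps)
  qed
  have y2: "y\<^sup>2 = x\<^sup>2 + x * (1 - \<epsilon>) + \<epsilon>\<^sup>2 / 4"
    unfolding y_def using x \<epsilon> by (intro real_sqrt_pow2 add_nonneg_nonneg mult_nonneg_nonneg) auto
  have "x \<le> y"
    unfolding y_def using x \<epsilon> by (intro real_le_rsqrt) auto
  then have y: "y \<ge> 1" using x by simp
  \<comment> \<open>Write \<open>z\<close> for \<open>\<tau> + \<epsilon> / (2 * d)\<close> and
    \<open>t\<close> for the quotient of the right side of \<open>key\<close> by \<open>z\<close>.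
    Then \<open>\<eta> / \<delta>\<close> is \<open>(t - 1) / (1 - t * \<gamma>)\<close>, which
    increases with \<open>t\<close>. The least \<open>t\<close> is attained at
    \<open>z = y / d\<close> and equals \<open>M\<close>; \<open>key\<close> records this
    value.\<close>
  define \<tau> where "\<tau> = (y - \<epsilon> / 2) / d"
  have d: "real d > 0" using d_pos by simp
  have \<tau>: "\<tau> > 0" using y \<epsilon> d by (auto simp: \<tau>_def)
  have key: "M * (y / d) = \<tau> + real S / 2 + \<epsilon> / (2 * real d) + real d * (\<tau> + real S)\<^sup>2 / 2"
    (is "_ = ?E")
  proof -
    have "(\<tau> + real S) = (y - \<epsilon> / 2 + x) / d" using d by (simp add: \<tau>_def x_def field_simps)
    then have "real d * (\<tau> + real S / 2 + \<epsilon> / (2 * real d) + real d * (\<tau> + real S)\<^sup>2 / 2) =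
        y + x / 2 + (y - \<epsilon> / 2 + x)\<^sup>2 / 2"
      using d by (simp add: \<tau>_def x_def field_simps power2_eq_square)
    also have "\<dots> = M * y + (x / 2 + (x\<^sup>2 - \<epsilon> * x + \<epsilon>\<^sup>2 / 4) / 2 - y\<^sup>2 / 2)"
      by (simp add: M' power2_eq_square algebra_simps add_divide_distrib diff_divide_distrib)
    also have "\<dots> = M * y" unfolding y2 by (simp add: algebra_simps add_divide_distrib diff_divide_distrib)
    finally have "M * (y / d) = real d * ?E / real d" by (simp only: times_divide_eq_right)
    then show ?thesis using d by simp
  qed
  define Q1 where "Q1 = ln (real_of_int \<bar>q1\<bar>)"
  define Q2 where "Q2 = ln (real_of_int \<bar>q2\<bar>)"
  have Q2: "Q2 \<ge> 0" using q2_nz by (simp add: Q2_def)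
  have Q: "ln (norm q) = Q1 - Q2" "Q1 > Q2"
    using norm_q q1_nz q2_nz ln_gt_zero[OF norm_q] by (auto simp: Q1_def Q2_def q_eq norm_divide ln_div)
  have Q1: "Q1 > 0" using Q Q2 by simp
  have Q2': "Q2 = \<gamma> * Q1" using Q1 by (simp add: \<gamma> Q1_def Q2_def)
  have M1: "M > 1" using x y \<epsilon> by (auto simp: M')
  define \<delta> where "\<delta> = ln (norm q) * (\<tau> + real S / 2 + \<epsilon> / (2 * real d)) - ln \<bar>q1\<bar> * (real S / 2)
      - ln \<bar>q2\<bar> * (real d * (\<tau> + real S)\<^sup>2 / 2)"
  define \<eta> where "\<eta> = ln \<bar>q1\<bar> * (real S / 2 + real d * (\<tau> + real S)\<^sup>2 / 2)"
  define Y where "Y = real d * (\<tau> + real S)\<^sup>2 / 2"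
  have tau_eq: "\<tau> + \<epsilon> / (2 * real d) = y / d" using d by (simp add: \<tau>_def field_simps)
  have Y: "Y = M * (y / d) - y / d - real S / 2" using key tau_eq by (simp add: Y_def)
  have "\<delta> = (Q1 - \<gamma> * Q1) * (y / d + real S / 2) - Q1 * (real S / 2) - \<gamma> * Q1 * Y"
    unfolding \<delta>_def Q Q1_def[symmetric] Q2_def[symmetric] Q2' Y_def tau_eq[symmetric] by (simp add: algebra_simps)
  then have \<delta>: "\<delta> = Q1 * (y / d) * (1 - M * \<gamma>)"
    unfolding Y by (simp add: algebra_simps add_divide_distrib diff_divide_distrib)
  have "\<eta> = Q1 * (real S / 2 + Y)" by (simp add: \<eta>_def Q1_def Y_def)
  then have \<eta>: "\<eta> = Q1 * (y / d) * (M - 1)"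
    unfolding Y by (simp add: algebra_simps add_divide_distrib diff_divide_distrib)
  have yd: "Q1 * (y / d) > 0" using Q1 y d by auto
  have "M * \<gamma> < 1" using \<gamma>M M1 by (simp add: field_simps)
  then have \<delta>_pos: "\<delta> > 0" unfolding \<delta> by (intro mult_pos_pos[OF yd]) simp
  have \<mu>': "\<eta> / \<delta> = \<mu>" unfolding \<delta> \<eta> \<mu> by (rule mult_divide_mult_cancel_left) (use yd in linarith)
  have "\<exists>K\<ge>1. \<exists>N1 c. (\<forall>l n. N1 \<le> n \<longrightarrow> (\<lambda>i. c l i * (1 / q ^ n) ^ (d * l + i)) sums G l n) \<and>
     (\<forall>l i. norm (c l i) \<le> K ^ (d * l + i) * exp (- ln (norm q) * (\<epsilon> * (real (d * l + i))\<^sup>2 / (2 * real d))))"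
  proof (cases "\<exists>p. p \<noteq> 0 \<and> P = monom p d")
    case True
    then have "\<epsilon> = 1" by (simp add: \<epsilon>_def)
    then show ?thesis using True expansion_monomial by auto
  next
    case False
    then have "\<epsilon> = 0" by (simp add: \<epsilon>_def)
    then show ?thesis using expansion_general by simp
  qed
  then obtain K N1 c where K: "K \<ge> 1"
    and sums: "\<And>l n. N1 \<le> n \<Longrightarrow> (\<lambda>i. c l i * (1 / q ^ n) ^ (d * l + i)) sums G l n"
    and c: "\<And>l i. norm (c l i) \<le> K ^ (d * l + i) * exp (- ln (norm q) * (\<epsilon> * (real (d * l + i))\<^sup>2 / (2 * real d)))"
    by blast
  have "\<epsilon> \<ge> 0" by (simp add: \<epsilon>_def)
  from lin_form_lower_bound_of_expansion[OF sums c K this \<tau> \<delta>_pos[unfolded \<delta>_def]] show ?thesis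
    unfolding \<delta>_def[symmetric] \<eta>_def[symmetric] \<mu>' .
qed

end

section \<open>Rational data\<close>

lemma map_poly_of_rat_pCons:
  "map_poly of_rat (pCons a p) = pCons (of_rat a) (map_poly of_rat p :: complex poly)"
  by (cases "a = 0 \<and> p = 0") (auto simp: map_poly_pCons)

lemma poly_map_poly_of_rat: "poly (map_poly of_rat p) (of_rat x :: complex) = of_rat (poly p x)"
  by (induction p) (simp_all add: map_poly_of_rat_pCons of_rat_add of_rat_mult)

lemma rat_common_denominator:
  assumes "finite X"
  shows "\<exists>b::int. b > 0 \<and> (\<forall>x\<in>X. of_int b * x \<in> (\<int> :: rat set))"
  using assms
proof (induction X rule: finite_induct)
  case (insert x X)
  then obtain b :: int where b: "b > 0" "\<And>x. x \<in> X \<Longrightarrow> of_int b * x \<in> (\<int> :: rat set)" by blast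
  obtain n e :: int where x: "x = of_int n / of_int e" "e > 0"
    by (cases x rule: Rat_cases) (auto simp: Fract_of_int_quotient)
  show ?case
  proof (intro exI[of _ "b * e"] conjI ballI)
    show "b * e > 0" using b x by simp
    fix y assume "y \<in> insert x X"
    then consider "y = x" | "y \<in> X" by blast
    then show "of_int (b * e) * y \<in> \<int>"
    proof cases
      case 1
      then have "of_int (b * e) * y = of_int (b * n)" using x by simp
      then show ?thesis by (metis Ints_of_int)
    next
      case 2
      have "of_int (b * e) * y = of_int e * (of_int b * y)" by simp
      then show ?thesis using b(2)[OF 2] by (metis Ints_mult Ints_of_int)
    qed
  qed
qed (auto intro: exI[of _ 1])

lemma of_rat_Ints: "x \<in> \<int> \<Longrightarrow> (of_rat x :: complex) \<in> \<int>"
  by (elim Ints_cases) simp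

text \<open>The hypotheses are transported along the embedding of the rationals into the complex
  numbers; \<open>b\<close> is a common denominator of the finitely many \<open>\<alpha> j\<close>
  and coefficients of \<open>P\<close>.\<close>

lemma q_rational_of_rat:
  fixes q :: rat and q1 q2 :: int and P :: "rat poly" and \<alpha> s
  assumes "q = of_int q1 / of_int q2" "q2 \<noteq> 0" "\<bar>q1\<bar> > \<bar>q2\<bar>"
    and "d = degree P" "d \<ge> 1"
    and "\<And>n::nat. n > 0 \<Longrightarrow> poly P (q ^ n) \<noteq> 0"
    and "\<And>j. j \<in> {1..m} \<Longrightarrow> \<alpha> j \<noteq> 0"
    and "\<And>j k. j \<in> {1..m} \<Longrightarrow> k \<in> {1..m} \<Longrightarrow> j \<noteq> k \<Longrightarrow>
           \<alpha> j * inverse (\<alpha> k) \<notin> {q powi n | n::int. True}"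
    and "\<And>j. j \<in> {1..m} \<Longrightarrow> \<alpha> j \<notin> {poly P 0 * q ^ n | n::nat. n > 0}"
  shows "\<exists>b. q_rational (of_rat q) (map_poly of_rat P) d m (\<lambda>j. of_rat (\<alpha> j)) q1 q2 b"
proof -
  have "finite (\<alpha> ` {1..m} \<union> coeff P ` {..d})" by simp
  then obtain b :: int where b: "b > 0"
    "\<And>x. x \<in> \<alpha> ` {1..m} \<union> coeff P ` {..d} \<Longrightarrow> of_int b * x \<in> (\<int> :: rat set)"
    using rat_common_denominator by meson
  have q: "q \<noteq> 0" using assms(1-3) by auto
  have "q_rational (of_rat q) (map_poly of_rat P) d m (\<lambda>j. of_rat (\<alpha> j)) q1 q2 b"
  proof
    show q_eq: "(of_rat q :: complex) = of_int q1 / of_int q2"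
      by (simp add: assms(1) of_rat_divide)
    have "real_of_int \<bar>q2\<bar> < real_of_int \<bar>q1\<bar>" using assms(3) by linarith
    then show "1 < norm (of_rat q :: complex)"
      using assms(2) unfolding q_eq by (simp add: norm_divide field_simps)
    show "d = degree (map_poly of_rat P :: complex poly)"
      using assms(4) by (simp add: degree_map_poly)
    show "poly (map_poly of_rat P) (of_rat q ^ n :: complex) \<noteq> 0" if "n > 0" for n
      using assms(6)[OF that] by (simp add: poly_map_poly_of_rat flip: of_rat_power)
    show "(of_rat (\<alpha> j) :: complex) \<noteq> 0" if "j \<in> {1..m}" for j
      using assms(7)[OF that] by simp
    show "j = k" if "j \<in> {1..m}" "k \<in> {1..m}"
      and eq: "of_rat (\<alpha> j) * of_rat q ^ a = (of_rat (\<alpha> k) * of_rat q ^ b :: complex)" for j k a b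
    proof (rule ccontr)
      assume "j \<noteq> k"
      have "\<alpha> j * q ^ a = \<alpha> k * q ^ b"
        using eq by (simp flip: of_rat_mult of_rat_power)
      then have "\<alpha> j * inverse (\<alpha> k) = q powi (int b - int a)"
        using q assms(7)[OF that(2)] by (simp add: power_int_diff field_simps)
      then show False using assms(8)[OF that(1,2) \<open>j \<noteq> k\<close>] by blast
    qed
    show "of_rat (\<alpha> j) \<noteq> poly (map_poly of_rat P) 0 * (of_rat q ^ n :: complex)"
      if "j \<in> {1..m}" "n > 0" for j n
    proof
      assume "of_rat (\<alpha> j) = poly (map_poly of_rat P) 0 * (of_rat q ^ n :: complex)"
      then have "\<alpha> j = poly P 0 * q ^ n"
        using poly_map_poly_of_rat[of P 0] by (simp flip: of_rat_mult of_rat_power)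
      then show False using assms(9)[OF that(1)] that(2) by blast
    qed
    show "of_int b * of_rat (\<alpha> j) \<in> (\<int> :: complex set)" if "j \<in> {1..m}" for j
      using of_rat_Ints[OF b(2), of "\<alpha> j"] that by (simp add: of_rat_mult)
    show "of_int b * coeff (map_poly of_rat P) i \<in> (\<int> :: complex set)" for i
    proof (cases "i \<le> d")
      case True
      then show ?thesis using of_rat_Ints[OF b(2), of "coeff P i"] by (simp add: of_rat_mult coeff_map_poly)
    qed (use assms(4) in \<open>simp add: coeff_map_poly coeff_eq_0\<close>)
  qed (use assms b in auto)
  then show ?thesis ..
qed

theorem theorem1:
  fixes q :: rat and q\<^sub>1 q\<^sub>2 :: int and P :: "rat poly" and d m S :: nat
    and \<alpha> :: "nat \<Rightarrow> rat" and s :: "nat \<Rightarrow> nat" and \<gamma> M \<mu> :: real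
    and f :: "complex \<Rightarrow> complex"
  assumes "q = of_int q\<^sub>1 / of_int q\<^sub>2" and "q\<^sub>1 \<noteq> 0" and "q\<^sub>2 \<noteq> 0"
    and "gcd q\<^sub>1 q\<^sub>2 = 1" and "\<bar>q\<^sub>1\<bar> > \<bar>q\<^sub>2\<bar>"
    and "\<gamma> = ln (real_of_int \<bar>q\<^sub>2\<bar>) / ln (real_of_int \<bar>q\<^sub>1\<bar>)"
    and "d = degree P" and "d \<ge> 1"
    and "\<And>n::nat. n > 0 \<Longrightarrow> poly P (q ^ n) \<noteq> 0"
    and "f = qexp_series q P"
    and "m > 0"
    and "\<And>j. j \<in> {1..m} \<Longrightarrow> \<alpha> j \<noteq> 0"
    and "\<And>j k. j \<in> {1..m} \<Longrightarrow> k \<in> {1..m} \<Longrightarrow> j \<noteq> k \<Longrightarrow>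
           \<alpha> j * inverse (\<alpha> k) \<notin> {q powi n | n::int. True}"
    and "\<And>j. j \<in> {1..m} \<Longrightarrow> \<alpha> j \<notin> {poly P 0 * q ^ n | n::nat. n > 0}"
    and "\<And>j. j \<in> {1..m} \<Longrightarrow> s j > 0"
    and "S = (\<Sum>j=1..m. s j)"
    and "M = (if \<exists>p. p \<noteq> 0 \<and> P = monom p d
              then real d * real S + 1/2 + sqrt ((real d)\<^sup>2 * (real S)\<^sup>2 + 1/4)
              else real d * real S + 1 + sqrt (real d * real S * (real d * real S + 1)))"
    and "\<mu> = (M - 1) / (1 - M * \<gamma>)"
    and "\<gamma> < 1 / M"
  shows "rat_lin_indep_family
           (insert None (Some ` {(j, k, \<sigma>). j \<in> {1..m} \<and> k < d \<and> \<sigma> < s j}))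
           (\<lambda>i. case i of None \<Rightarrow> 1
                 | Some (j, k, \<sigma>) \<Rightarrow> (deriv ^^ \<sigma>) f (of_rat (\<alpha> j * q ^ k)))
       \<and> (\<exists>C\<^sub>0 > (0::real). \<forall>(A\<^sub>0::int) (A :: nat \<Rightarrow> nat \<Rightarrow> nat \<Rightarrow> int).
           (A\<^sub>0 \<noteq> 0 \<or> (\<exists>j\<in>{1..m}. \<exists>k<d. \<exists>\<sigma><s j. A j k \<sigma> \<noteq> 0)) \<longrightarrow>
           (let H = real_of_int (Max (insert 2 {\<bar>A j k \<sigma>\<bar> | j k \<sigma>. j \<in> {1..m} \<and> k < d \<and> \<sigma> < s j}))
            in norm (of_int A\<^sub>0 + (\<Sum>j=1..m. \<Sum>k<d. \<Sum>\<sigma><s j.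
                    of_int (A j k \<sigma>) * (deriv ^^ \<sigma>) f (of_rat (\<alpha> j * q ^ k))))
               \<ge> H powr (- \<mu> - C\<^sub>0 / sqrt (ln H))))"
proof -
  let ?q = "of_rat q :: complex" and ?P = "map_poly of_rat P :: complex poly"
    and ?\<alpha> = "\<lambda>j. of_rat (\<alpha> j) :: complex"
  have "\<exists>b. q_rational ?q ?P d m ?\<alpha> q\<^sub>1 q\<^sub>2 b"
    by (rule q_rational_of_rat) (fact assms)+
  then obtain b where "q_rational ?q ?P d m ?\<alpha> q\<^sub>1 q\<^sub>2 b" ..
  then interpret L: q_rational ?q ?P d m ?\<alpha> s q\<^sub>1 q\<^sub>2 b .
  have S: "L.S = S" by (simp add: L.S_def assms(16))
  have "s 1 \<le> S" unfolding assms(16) using assms(11) by (intro member_le_sum) auto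
  then have S_pos: "S > 0" using assms(11) assms(15)[of 1] by simp
  \<comment> \<open>The case distinction in \<open>M\<close> must agree for \<open>P\<close> and its
    complex image; injectivity of the embedding ensures this.\<close>
  have monom_iff: "(\<exists>p. p \<noteq> 0 \<and> ?P = monom p d) \<longleftrightarrow> (\<exists>p. p \<noteq> 0 \<and> P = monom p d)"
  proof
    assume "\<exists>p. p \<noteq> 0 \<and> ?P = monom p d"
    then obtain p where "?P = monom p d" by blast
    then have "coeff P i = 0" if "i \<noteq> d" for i
      using that by (metis coeff_map_poly coeff_monom of_rat_0 of_rat_eq_0_iff)
    then have "P = monom (coeff P d) d" by (auto simp: poly_eq_iff)
    moreover have "coeff P d \<noteq> 0" using assms(7,8) by auto
    ultimately show "\<exists>p. p \<noteq> 0 \<and> P = monom p d" by blast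
  next
    assume "\<exists>p. p \<noteq> 0 \<and> P = monom p d"
    then obtain p where "p \<noteq> 0" "P = monom p d" by blast
    then have "?P = monom (of_rat p) d" "of_rat p \<noteq> (0 :: complex)"
      by (simp_all add: map_poly_monom)
    then show "\<exists>p. p \<noteq> 0 \<and> ?P = monom p d" by blast
  qed
  have f: "f = L.series"
    by (simp add: assms(10) L.series_def qexp_series_def L.P_prod_def fun_eq_iff of_rat_prod
        flip: poly_map_poly_of_rat of_rat_power)
  define val where "val = (\<lambda>(j, k, \<sigma>). (deriv ^^ \<sigma>) f (of_rat (\<alpha> j * q ^ k)))"
  have lin_form: "L.lin_form A0 A = A0 + (\<Sum>i\<in>L.idx. A i * val i)" for A0 A
    by (simp add: L.lin_form_def val_def f case_prod_unfold of_rat_mult of_rat_power)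
  from L.lin_form_lower_bound[OF assms(6) _ _ assms(18,19), unfolded monom_iff S, OF S_pos assms(17)]
  obtain C where C: "C > 0" and C_bound: "\<And>H A0 A. 2 \<le> H \<Longrightarrow> A0 \<in> \<int> \<Longrightarrow>
     (\<forall>i\<in>L.idx. A i \<in> \<int> \<and> norm (A i) \<le> H) \<Longrightarrow> (A0 \<noteq> 0 \<or> (\<exists>i\<in>L.idx. A i \<noteq> 0)) \<Longrightarrow>
     H powr (- \<mu> - C / sqrt (ln H)) \<le> norm (L.lin_form A0 A)" by blast
  have idx: "L.idx = {(j, k, \<sigma>). j \<in> {1..m} \<and> k < d \<and> \<sigma> < s j}" by auto
  show ?thesis
  proof
    show "rat_lin_indep_family (insert None (Some ` {(j, k, \<sigma>). j \<in> {1..m} \<and> k < d \<and> \<sigma> < s j}))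
           (\<lambda>i. case i of None \<Rightarrow> 1 | Some (j, k, \<sigma>) \<Rightarrow> (deriv ^^ \<sigma>) f (of_rat (\<alpha> j * q ^ k)))"
      unfolding rat_lin_indep_family_def idx[symmetric]
    proof (intro allI impI ballI, elim conjE)
      fix J :: "(nat \<times> nat \<times> nat) option set" and c :: "_ \<Rightarrow> rat" and i
      assume fin: "finite J" and J: "J \<subseteq> insert None (Some ` L.idx)" and i: "i \<in> J"
        and sum0: "(\<Sum>i\<in>J. of_rat (c i) * (case i of None \<Rightarrow> 1
          | Some (j, k, \<sigma>) \<Rightarrow> (deriv ^^ \<sigma>) f (of_rat (\<alpha> j * q ^ k)))) = 0"
      show "c i = 0"
      proof (rule ccontr)
        assume ci: "c i \<noteq> 0"
        \<comment> \<open>Independence follows from the lower bound: clearing denominators in a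
          rational relation and extending it by zero outside \<open>J\<close> gives an integral form
          with value 0.\<close>
        obtain e :: int where e: "e > 0" "\<And>i. i \<in> J \<Longrightarrow> of_int e * c i \<in> (\<int> :: rat set)"
          using rat_common_denominator[of "c ` J"] fin by auto
        define a where "a i = (if i \<in> J then of_rat (of_int e * c i) else 0 :: complex)" for i
        define x where "x = (\<lambda>i. case i of None \<Rightarrow> 1 | Some i \<Rightarrow> val i)"
        have a_int: "a i \<in> \<int>" for i
          using e(2) of_rat_Ints by (auto simp: a_def)
        have ai: "a i \<noteq> 0" using ci e i by (simp add: a_def)
        have "L.lin_form (a None) (\<lambda>i. a (Some i)) = (\<Sum>i\<in>insert None (Some ` L.idx). a i * x i)"
          by (simp add: lin_form x_def sum.reindex)
        also have "\<dots> = (\<Sum>i\<in>J. a i * x i)"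
          using J by (intro sum.mono_neutral_right) (auto simp: a_def)
        also have "\<dots> = of_int e * (\<Sum>i\<in>J. of_rat (c i) * (case i of None \<Rightarrow> 1
          | Some (j, k, \<sigma>) \<Rightarrow> (deriv ^^ \<sigma>) f (of_rat (\<alpha> j * q ^ k))))"
          unfolding sum_distrib_left
          by (intro sum.cong refl) (auto simp: a_def x_def val_def of_rat_mult split: option.splits)
        finally have zero: "L.lin_form (a None) (\<lambda>i. a (Some i)) = 0" using sum0 by simp
        \<comment> \<open>Any bound on the coefficients that is at least 2 will do, since a positive
          lower bound already contradicts the value 0.\<close>
        define H where "H = 2 + (\<Sum>i\<in>L.idx. norm (a (Some i)))"
        have H: "2 \<le> H" by (auto simp: H_def intro: sum_nonneg)
        have "norm (a (Some i)) \<le> H" if "i \<in> L.idx" for i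
          using member_le_sum[OF that, of "\<lambda>i. norm (a (Some i))"] by (simp add: H_def)
        moreover have "a None \<noteq> 0 \<or> (\<exists>i\<in>L.idx. a (Some i) \<noteq> 0)"
          using ai i J by (cases i) auto
        ultimately have "H powr (- \<mu> - C / sqrt (ln H)) \<le> norm (L.lin_form (a None) (\<lambda>i. a (Some i)))"
          using H a_int by (intro C_bound) auto
        then show False using H zero by simp
      qed
    qed
  next
    show "\<exists>C\<^sub>0 > (0::real). \<forall>(A\<^sub>0::int) (A :: nat \<Rightarrow> nat \<Rightarrow> nat \<Rightarrow> int).
           (A\<^sub>0 \<noteq> 0 \<or> (\<exists>j\<in>{1..m}. \<exists>k<d. \<exists>\<sigma><s j. A j k \<sigma> \<noteq> 0)) \<longrightarrow>
           (let H = real_of_int (Max (insert 2 {\<bar>A j k \<sigma>\<bar> | j k \<sigma>. j \<in> {1..m} \<and> k < d \<and> \<sigma> < s j}))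
            in norm (of_int A\<^sub>0 + (\<Sum>j=1..m. \<Sum>k<d. \<Sum>\<sigma><s j.
                    of_int (A j k \<sigma>) * (deriv ^^ \<sigma>) f (of_rat (\<alpha> j * q ^ k))))
               \<ge> H powr (- \<mu> - C\<^sub>0 / sqrt (ln H)))"
    proof (intro exI[of _ C] conjI C allI impI)
      fix A\<^sub>0 :: int and A :: "nat \<Rightarrow> nat \<Rightarrow> nat \<Rightarrow> int"
      assume nz: "A\<^sub>0 \<noteq> 0 \<or> (\<exists>j\<in>{1..m}. \<exists>k<d. \<exists>\<sigma><s j. A j k \<sigma> \<noteq> 0)"
      define X where "X = {\<bar>A j k \<sigma>\<bar> | j k \<sigma>. j \<in> {1..m} \<and> k < d \<and> \<sigma> < s j}"
      define H where "H = real_of_int (Max (insert 2 X))"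
      have X: "X = (\<lambda>(j, k, \<sigma>). \<bar>A j k \<sigma>\<bar>) ` L.idx"
      proof (intro equalityI subsetI)
        fix x assume "x \<in> X"
        then obtain j k \<sigma> where "x = \<bar>A j k \<sigma>\<bar>" "(j, k, \<sigma>) \<in> L.idx"
          unfolding X_def by auto
        then show "x \<in> (\<lambda>(j, k, \<sigma>). \<bar>A j k \<sigma>\<bar>) ` L.idx"
          by (intro image_eqI[of _ _ "(j, k, \<sigma>)"]) auto
      qed (auto simp: X_def, blast)
      have fin: "finite X" by (simp add: X)
      define B where "B = (\<lambda>(j, k, \<sigma>). of_int (A j k \<sigma>) :: complex)"
      have eq: "L.lin_form (of_int A\<^sub>0) B = of_int A\<^sub>0 + (\<Sum>j=1..m. \<Sum>k<d. \<Sum>\<sigma><s j.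
                    of_int (A j k \<sigma>) * (deriv ^^ \<sigma>) f (of_rat (\<alpha> j * q ^ k)))"
        unfolding lin_form L.idx_def B_def val_def
        by (simp add: sum.Sigma case_prod_unfold)
      have "2 \<le> Max (insert 2 X)" using fin by (intro Max_ge) auto
      then have H: "2 \<le> H" unfolding H_def by linarith
      have "norm (B i) \<le> H" if "i \<in> L.idx" for i
      proof -
        obtain j k \<sigma> where i: "i = (j, k, \<sigma>)" by (cases i)
        then have "\<bar>A j k \<sigma>\<bar> \<in> X"
          unfolding X using that by (intro image_eqI[of _ _ "(j, k, \<sigma>)"]) simp_all
        then have "\<bar>A j k \<sigma>\<bar> \<le> Max (insert 2 X)" using fin by (intro Max_ge) auto
        then have "real_of_int \<bar>A j k \<sigma>\<bar> \<le> H" unfolding H_def by (simp only: of_int_le_iff)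
        then show ?thesis by (simp add: B_def i)
      qed
      moreover have "(of_int A\<^sub>0 :: complex) \<noteq> 0 \<or> (\<exists>i\<in>L.idx. B i \<noteq> 0)"
      proof (cases "A\<^sub>0 = 0")
        case True
        then obtain j k \<sigma> where "(j, k, \<sigma>) \<in> L.idx" "A j k \<sigma> \<noteq> 0"
          using nz by auto
        then have "(j, k, \<sigma>) \<in> L.idx \<and> B (j, k, \<sigma>) \<noteq> 0" by (simp add: B_def)
        then show ?thesis by blast
      qed simp
      ultimately have "H powr (- \<mu> - C / sqrt (ln H)) \<le> norm (L.lin_form (of_int A\<^sub>0) B)"
        using H by (intro C_bound) (auto simp: B_def)
      then show "let H = real_of_int (Max (insert 2 {\<bar>A j k \<sigma>\<bar> | j k \<sigma>. j \<in> {1..m} \<and> k < d \<and> \<sigma> < s j}))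
            in H powr (- \<mu> - C / sqrt (ln H)) \<le> norm (of_int A\<^sub>0 + (\<Sum>j=1..m. \<Sum>k<d. \<Sum>\<sigma><s j.
                    of_int (A j k \<sigma>) * (deriv ^^ \<sigma>) f (of_rat (\<alpha> j * q ^ k))))"
        unfolding eq Let_def H_def X_def .
    qed
  qed
qed

end
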